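(* Let $p$ be an odd prime, $n\geqslant1$, $1\leqslant k\leqslant n$, $0\leqslant s_1<\cdots<s_k\leqslant n-1$, and set $s_0=0$. Let $\Delta_i$ ($0\leqslant i\leqslant n$) be the sequences of length $n$ defined in the context. Then $$St^{\emptyset,\Delta_i}M_{n,s_1,\ldots,s_k}=\begin{cases}(-1)^{s_t-t}\,M_{n,s_0,\ldots,\hat s_t,\ldots,s_k}, & s_1>0,\ i=s_t,\\[4pt] \displaystyle\sum_{t=0}^{k}(-1)^{n-t-1}\,M_{n,s_0,\ldots,\hat s_t,\ldots,s_k}\,Q_{n,s_t}, & s_1>0,\ i=n,\\[4pt] 0, & \text{otherwise,}\end{cases}$$ where in the first case $t$ is an index with $0\leqslant t\leqslant k$.
   Context: All cohomology has coefficients in $\mathbb Z/p$. $H^*(B(\mathbb Z/p)^n)=E(x_1,\ldots,x_n)\otimes P(y_1,\ldots,y_n)$ with $\dim x_i=1$, $y_i=\beta x_i$ ($\beta$ the Bockstein homomorphism), where $E$ and $P$ denote exterior and polynomial algebras over $\mathbb Z/p$. A hat denotes omission. For non-negative integers $a_{k+1},\ldots,a_n$, define $$[k;a_{k+1},\ldots,a_n]=\sum_I \operatorname{sign}(\sigma_I)\,x_{i_1}\cdots x_{i_k}\,\det\big(y_{i_u}^{p^{a_v}}\big)_{k+1\leqslant u,v\leqslant n},$$ the sum over all $k$-element subsets $I=\{i_1<\cdots<i_k\}$ of $\{1,\ldots,n\}$ with complement $\{i_{k+1}<\cdots<i_n\}$, where $\sigma_I$ is the permutation $j\mapsto i_j$.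 For $k=0$ write $[a_1,\ldots,a_n]=\det(y_i^{p^{a_j}})$. Set $L_{n,s}=[0,\ldots,\hat s,\ldots,n]$ for $0\leqslant s\leqslant n$, and $L_n=L_{n,n}=[0,\ldots,n-1]$. The Dickson invariants are $Q_{n,s}=L_{n,s}/L_n$ (a polynomial). The M\`ui invariants are, for $0\leqslant u_1<\cdots<u_k\leqslant n-1$, $M_{n,u_1,\ldots,u_k}=[k;0,\ldots,\hat u_1,\ldots,\hat u_k,\ldots,n-1]$. $\Delta_i=(0,\ldots,1,\ldots,0)$ is the sequence of length $n$ with $1$ in the $i$-th place ($1\leqslant i\leqslant n$), and $\Delta_0=(0,\ldots,0)$. Let $\mathcal A(p)$ be the mod $p$ Steenrod algebra. By Milnor, its dual is $\mathcal A(p)^*=E(\tau_0,\tau_1,\ldots)\otimes P(\xi_1,\xi_2,\ldots)$ with $\dim\tau_s=2p^s-1$, $\dim\xi_i=2p^i-2$. It has the basis of monomials $\tau_S\xi^R=\tau_{s_1}\cdots\tau_{s_t}\xi_1^{r_1}\cdots\xi_m^{r_m}$ ($S=(s_1,\ldots,s_t)$, $0\leqslant s_1<\cdots<s_t$, $R=(r_1,\ldots,r_m)$), and $St^{S,R}\in\mathcal A(p)$ is the element of the dual basis dual to $\tau_S\xi^R$; $St^{\emptyset,R}$ is the case where $S$ is empty. $\mathcal A(p)$ acts on $H^*(B(\mathbb Z/p)^n)$ in the usual way.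
   Formalization: The "otherwise" value 0 is false for s_1=0, i=0: Δ_0=(0,…,0), so the operation is the identity (n=k=1 gives M_{1,0}=x_1≠0); there the formal theorem states the value M_{n,s_1,…,s_k} instead of 0. *)

theory Defs
  imports
    "Berlekamp_Zassenhaus.Finite_Field"
    "Jordan_Normal_Form.Determinant"
    "HOL-Library.Poly_Mapping"
    "HOL-Combinatorics.Permutations"
begin

text \<open>
  The prime is \<open>p = CARD('p)\<close> for a type \<open>'p\<close> of class \<open>prime_card\<close>, and
  the field of coefficients is \<open>'p mod_ring\<close>.
\<close>

section \<open>The algebra \<open>E(x\<^sub>0, x\<^sub>1, \<dots>) \<otimes> P(y\<^sub>0, y\<^sub>1, \<dots>)\<close>\<close>

type_synonym 'p pol = "(nat \<Rightarrow>\<^sub>0 nat) \<Rightarrow>\<^sub>0 'p mod_ring"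

text \<open>
  An element is a finite sum \<open>\<Sum>\<^sub>S x\<^sub>S f\<^sub>S\<close> over finite sets \<open>S\<close>, where
  \<open>x\<^sub>S = x\<^bsub>s1\<^esub> \<cdots> x\<^bsub>st\<^esub>\<close> for \<open>S = {s1 < \<cdots> < st}\<close> and \<open>f\<^sub>S\<close> is a polynomial in the \<open>y\<^sub>i\<close>;
  it is represented by the function \<open>S \<mapsto> f\<^sub>S\<close>.
\<close>

typedef (overloaded) ('p::prime_card) extpol =
  "{f :: nat set \<Rightarrow> 'p pol. finite {S. f S \<noteq> 0} \<and> (\<forall>S. f S \<noteq> 0 \<longrightarrow> finite S)}"
  morphisms component Abs_extpol
  by (rule exI[of _ "\<lambda>_. 0"]) simp

text \<open>
  For disjoint \<open>A\<close> and \<open>B\<close>, \<open>x\<^sub>A x\<^sub>B = shuffle_sign A B \<cdot> x\<^bsub>A \<union> B\<^esub>\<close>.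
\<close>

definition shuffle_sign :: "nat set \<Rightarrow> nat set \<Rightarrow> 'a::comm_ring_1" where
  "shuffle_sign A B = (-1) ^ card {(a, b). a \<in> A \<and> b \<in> B \<and> b < a}"

lemma shuffle_sign_empty [simp]: "shuffle_sign {} B = 1" "shuffle_sign A {} = 1"
  by (simp_all add: shuffle_sign_def)

lemma shuffle_sign_assoc:
  assumes "finite A" "finite B" "finite C" "A \<inter> B = {}" "B \<inter> C = {}" "A \<inter> C = {}"
  shows "shuffle_sign A B * shuffle_sign (A \<union> B) C
       = (shuffle_sign A (B \<union> C) * shuffle_sign B C :: 'a::comm_ring_1)"
proof -
  let ?I = "\<lambda>A B. {(a::nat, b). a \<in> A \<and> b \<in> B \<and> b < a}"
  have fin: "finite (?I A B)" if "finite A" "finite B" for A B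
    by (rule finite_subset[of _ "A \<times> B"]) (use that in auto)
  have 1: "card (?I (A \<union> B) C) = card (?I A C) + card (?I B C)"
    by (subst card_Un_disjoint[symmetric]) (use assms fin in \<open>auto intro!: arg_cong[where f = card]\<close>)
  have 2: "card (?I A (B \<union> C)) = card (?I A B) + card (?I A C)"
    by (subst card_Un_disjoint[symmetric]) (use assms fin in \<open>auto intro!: arg_cong[where f = card]\<close>)
  show ?thesis
    unfolding shuffle_sign_def 1 2 by (simp add: power_add mult_ac)
qed

lemma component_finite: "finite {S. component f S \<noteq> 0}"
  and component_infinite: "infinite S \<Longrightarrow> component f S = 0"
  using component[of f] by auto

lemma extpol_eqI: "(\<And>S. finite S \<Longrightarrow> component f S = component g S) \<Longrightarrow> f = g"
  by (metis component_infinite component_inject ext)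

instantiation extpol :: (prime_card) ring_1
begin

definition zero_extpol :: "'a extpol" where
  "0 = Abs_extpol (\<lambda>_. 0)"

definition one_extpol :: "'a extpol" where
  "1 = Abs_extpol (\<lambda>S. if S = {} then 1 else 0)"

definition plus_extpol :: "'a extpol \<Rightarrow> 'a extpol \<Rightarrow> 'a extpol" where
  "f + g = Abs_extpol (\<lambda>S. component f S + component g S)"

definition uminus_extpol :: "'a extpol \<Rightarrow> 'a extpol" where
  "- f = Abs_extpol (\<lambda>S. - component f S)"

definition minus_extpol :: "'a extpol \<Rightarrow> 'a extpol \<Rightarrow> 'a extpol" where
  "f - g = Abs_extpol (\<lambda>S. component f S - component g S)"

definition times_extpol :: "'a extpol \<Rightarrow> 'a extpol \<Rightarrow> 'a extpol" where
  "f * g = Abs_extpol (\<lambda>S. if finite S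
     then \<Sum>T\<in>Pow S. shuffle_sign T (S - T) * component f T * component g (S - T) else 0)"

lemma component_zero [simp]: "component (0 :: 'a extpol) S = 0"
  by (simp add: zero_extpol_def Abs_extpol_inverse)

lemma component_one: "component (1 :: 'a extpol) S = (if S = {} then 1 else 0)"
  by (simp add: one_extpol_def Abs_extpol_inverse)

lemma component_plus [simp]:
  fixes f g :: "'a extpol"
  shows "component (f + g) S = component f S + component g S"
proof -
  have "finite {S. component f S + component g S \<noteq> 0}"
    by (rule finite_subset[OF _ finite_UnI[OF component_finite[of f] component_finite[of g]]]) auto
  moreover have "finite S" if "component f S + component g S \<noteq> 0" for S
  proof (rule ccontr)
    assume "infinite S"
    then have "component f S = 0" "component g S = 0" by (simp_all add: component_infinite)
    with that show False by simp
  qed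
  ultimately have "(\<lambda>S. component f S + component g S)
      \<in> {f. finite {S. f S \<noteq> 0} \<and> (\<forall>S. f S \<noteq> 0 \<longrightarrow> finite S)}"
    by blast
  then show ?thesis
    by (simp add: plus_extpol_def Abs_extpol_inverse)
qed

lemma component_uminus [simp]:
  fixes f :: "'a extpol"
  shows "component (- f) S = - component f S"
  unfolding uminus_extpol_def using component[of f]
  by (subst Abs_extpol_inverse) auto

lemma component_minus [simp]:
  fixes f g :: "'a extpol"
  shows "component (f - g) S = component f S - component g S"
proof -
  have "finite {S. component f S - component g S \<noteq> 0}"
    by (rule finite_subset[OF _ finite_UnI[OF component_finite[of f] component_finite[of g]]]) auto
  moreover have "finite S" if "component f S - component g S \<noteq> 0" for S
  proof (rule ccontr)
    assume "infinite S"
    then have "component f S = 0" "component g S = 0" by (simp_all add: component_infinite)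
    with that show False by simp
  qed
  ultimately have "(\<lambda>S. component f S - component g S)
      \<in> {f. finite {S. f S \<noteq> 0} \<and> (\<forall>S. f S \<noteq> 0 \<longrightarrow> finite S)}"
    by blast
  then show ?thesis
    by (simp add: minus_extpol_def Abs_extpol_inverse)
qed

lemma component_times:
  fixes f g :: "'a extpol"
  assumes "finite S"
  shows "component (f * g) S
       = (\<Sum>T\<in>Pow S. shuffle_sign T (S - T) * component f T * component g (S - T))"
proof -
  let ?h = "\<lambda>S. if finite S
     then \<Sum>T\<in>Pow S. shuffle_sign T (S - T) * component f T * component g (S - T) else 0"
  let ?X = "{S. component f S \<noteq> 0} \<times> {S. component g S \<noteq> 0}"
  have "{S. ?h S \<noteq> 0} \<subseteq> (\<lambda>(T, U). T \<union> U) ` ?X"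
  proof
    fix S assume "S \<in> {S. ?h S \<noteq> 0}"
    then have "(\<Sum>T\<in>Pow S. shuffle_sign T (S - T) * component f T * component g (S - T)) \<noteq> 0"
      by (auto split: if_splits)
    then obtain T where T: "T \<subseteq> S"
      "shuffle_sign T (S - T) * component f T * component g (S - T) \<noteq> 0"
      by (metis (mono_tags, lifting) PowD sum.not_neutral_contains_not_neutral)
    then have "(T, S - T) \<in> ?X" by auto
    moreover have "S = (case (T, S - T) of (T, U) \<Rightarrow> T \<union> U)" using T by auto
    ultimately show "S \<in> (\<lambda>(T, U). T \<union> U) ` ?X" by (metis (no_types) image_eqI)
  qed
  then have "finite {S. ?h S \<noteq> 0}"
    by (rule finite_subset) (intro finite_imageI finite_cartesian_product component_finite)
  moreover have "finite S" if "?h S \<noteq> 0" for S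
    using that by meson
  ultimately have "?h \<in> {f. finite {S. f S \<noteq> 0} \<and> (\<forall>S. f S \<noteq> 0 \<longrightarrow> finite S)}"
    by blast
  then have "component (f * g) S = ?h S"
    unfolding times_extpol_def by (simp only: Abs_extpol_inverse)
  with assms show ?thesis by simp
qed

instance
proof
  fix a b c :: "'a extpol"
  show "a * b * c = a * (b * c)"
  proof (rule extpol_eqI)
    fix S :: "nat set" assume S: "finite S"
    have fin: "finite T" if "T \<subseteq> S" for T using that S finite_subset by blast
    let ?L = "\<lambda>T U. shuffle_sign T (S - T) * shuffle_sign U (T - U)
                * component a U * component b (T - U) * component c (S - T)"
    let ?R = "\<lambda>U V. shuffle_sign U (S - U) * shuffle_sign V (S - U - V)
                * component a U * component b V * component c (S - U - V)"
    have "component (a * b * c) S = (\<Sum>T\<in>Pow S. \<Sum>U\<in>Pow T. ?L T U)"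
      unfolding component_times[OF S]
      by (intro sum.cong refl) (simp add: component_times fin sum_distrib_left sum_distrib_right mult_ac)
    also have "\<dots> = (\<Sum>(T, U)\<in>(SIGMA T:Pow S. Pow T). ?L T U)"
      by (rule sum.Sigma) (use S fin in auto)
    also have "\<dots> = (\<Sum>(U, V)\<in>(SIGMA U:Pow S. Pow (S - U)). ?R U V)"
    proof (rule sum.reindex_bij_witness[where i = "\<lambda>(U, V). (U \<union> V, U)" and j = "\<lambda>(T, U). (U, T - U)"])
      fix z assume "z \<in> (SIGMA T:Pow S. Pow T)"
      then obtain T U where z: "z = (T, U)" "T \<subseteq> S" "U \<subseteq> T" by auto
      have eqs: "S - U - (T - U) = S - T" "U \<union> (T - U) = T" "T - U \<union> (S - T) = S - U"
        using z by auto
      have "shuffle_sign U (T - U) * shuffle_sign T (S - T)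
          = (shuffle_sign U (S - U) * shuffle_sign (T - U) (S - T) :: 'a pol)"
        using shuffle_sign_assoc[of U "T - U" "S - T", where ?'a = "'a pol"] z S fin
        unfolding eqs by (auto simp: fin)
      then have "?R U (T - U) = ?L T U"
        unfolding eqs(1) by (metis mult.commute)
      then show "(case (case z of (T, U) \<Rightarrow> (U, T - U)) of (U, V) \<Rightarrow> ?R U V) = (case z of (T, U) \<Rightarrow> ?L T U)"
        unfolding z prod.case .
    qed auto
    also have "\<dots> = (\<Sum>U\<in>Pow S. \<Sum>V\<in>Pow (S - U). ?R U V)"
      by (rule sum.Sigma[symmetric]) (use S in auto)
    also have "\<dots> = component (a * (b * c)) S"
      unfolding component_times[OF S]
      by (intro sum.cong refl) (simp add: component_times S sum_distrib_left sum_distrib_right mult_ac)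
    finally show "component (a * b * c) S = component (a * (b * c)) S" .
  qed
  show "1 * a = a"
  proof (rule extpol_eqI)
    fix S :: "nat set" assume S: "finite S"
    have "component (1 * a) S = (\<Sum>T\<in>Pow S. if T = {} then component a S else 0)"
      unfolding component_times[OF S] by (intro sum.cong refl) (simp add: component_one)
    then show "component (1 * a) S = component a S" using S by simp
  qed
  show "a * 1 = a"
  proof (rule extpol_eqI)
    fix S :: "nat set" assume S: "finite S"
    have "component (a * 1) S = (\<Sum>T\<in>Pow S. if T = S then component a S else 0)"
      unfolding component_times[OF S] by (intro sum.cong refl) (auto simp: component_one)
    then show "component (a * 1) S = component a S" using S by simp
  qed
  show "(a + b) * c = a * c + b * c" "a * (b + c) = a * b + a * c"
    by (rule extpol_eqI; simp add: component_times distrib_left distrib_right sum.distrib)+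
  show "(0::'a extpol) \<noteq> 1"
    using component_one[of "{}"] component_zero[of "{}"] by (metis zero_neq_one)
  show "a - b = a + - b" by (rule extpol_eqI) simp
qed (rule extpol_eqI; simp add: add_ac)+

end

definition of_pol :: "'p::prime_card pol \<Rightarrow> 'p extpol" where
  "of_pol q = Abs_extpol (\<lambda>S. if S = {} then q else 0)"

text \<open>\<open>monomial S R\<close> is \<open>x\<^sub>S y\<^sup>R\<close>, and \<open>coefficient z S R\<close> is its coefficient in \<open>z\<close>.\<close>

definition monomial :: "nat set \<Rightarrow> (nat \<Rightarrow>\<^sub>0 nat) \<Rightarrow> 'p::prime_card extpol" where
  "monomial S R = Abs_extpol (\<lambda>T. if T = S then Poly_Mapping.single R 1 else 0)"

definition coefficient :: "'p::prime_card extpol \<Rightarrow> nat set \<Rightarrow> (nat \<Rightarrow>\<^sub>0 nat) \<Rightarrow> 'p mod_ring" where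
  "coefficient z S R = Poly_Mapping.lookup (component z S) R"

definition scalar :: "'p::prime_card mod_ring \<Rightarrow> 'p extpol" where
  "scalar c = of_pol (Poly_Mapping.single 0 c)"

lemma coefficient_monomial:
  "finite S \<Longrightarrow> coefficient (monomial S R) S' R' = (if S' = S \<and> R' = R then 1 else 0)"
  unfolding coefficient_def monomial_def
  by (subst Abs_extpol_inverse) (auto simp: lookup_single when_def)

text \<open>The automorphism multiplying a homogeneous element \<open>z\<close> by \<open>(-1)\<^bsup>dim z\<^esup>\<close>.\<close>

definition involution :: "'p::prime_card extpol \<Rightarrow> 'p extpol" where
  "involution z = Abs_extpol (\<lambda>S. (-1) ^ card S * component z S)"


section \<open>Cohomology of \<open>B(\<int>/p)\<^sup>n\<close> and the Steenrod algebra\<close>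

text \<open>
  The algebra \<open>H\<^sup>*(B(\<int>/p)\<^sup>n) = E(x\<^sub>1, \<dots>, x\<^sub>n) \<otimes> P(y\<^sub>1, \<dots>, y\<^sub>n)\<close> is the subalgebra of
  \<open>'p extpol\<close> on the generators with indices \<open>1, \<dots>, n\<close>. The projections
  \<open>(\<int>/p)\<^bsup>n+1\<^esup> \<rightarrow> (\<int>/p)\<^sup>n\<close> identify these algebras for different \<open>n\<close>, compatibly with the
  Steenrod operations.
\<close>

definition gen_x :: "nat \<Rightarrow> 'p::prime_card extpol" where
  "gen_x i = monomial {i} 0"

definition gen_y :: "nat \<Rightarrow> 'p::prime_card pol" where
  "gen_y i = Poly_Mapping.single (Poly_Mapping.single i 1) 1"

text \<open>
  Milnor's algebra \<open>A(p)\<^sup>* = E(\<tau>\<^sub>0, \<tau>\<^sub>1, \<dots>) \<otimes> P(\<xi>\<^sub>1, \<xi>\<^sub>2, \<dots>)\<close> is the subalgebra of another copy of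
  \<open>'p extpol\<close>, with \<open>\<tau>\<^sub>s\<close> for the exterior and \<open>\<xi>\<^sub>i\<close> for the polynomial generators; the
  polynomial generator with index \<open>0\<close> is not used. Its basis of monomials \<open>\<tau>\<^sub>S \<xi>\<^sup>R\<close> is
  indexed by the following set.
\<close>

definition milnor_indices :: "(nat set \<times> (nat \<Rightarrow>\<^sub>0 nat)) set" where
  "milnor_indices = {(S, R). finite S \<and> 0 \<notin> Poly_Mapping.keys R}"

definition milnor_monomial :: "nat set \<Rightarrow> (nat \<Rightarrow>\<^sub>0 nat) \<Rightarrow> 'p::prime_card extpol" where
  "milnor_monomial S R = monomial S R"

text \<open>
  \<open>A(p)\<close> is of finite type, so it is the graded dual of \<open>A(p)\<^sup>*\<close>: the linear forms that vanish
  on almost all monomials. The basis dual to the monomials consists of the coefficient forms.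
\<close>

type_synonym 'p operation = "'p extpol \<Rightarrow> 'p mod_ring"

definition steenrod_algebra :: "'p::prime_card operation set" where
  "steenrod_algebra = {\<theta>. (\<forall>u v. \<theta> (u + v) = \<theta> u + \<theta> v) \<and> (\<forall>c u. \<theta> (scalar c * u) = c * \<theta> u)
     \<and> finite {(S, R). (S, R) \<in> milnor_indices \<and> \<theta> (milnor_monomial S R) \<noteq> 0}}"

definition St :: "nat set \<Rightarrow> (nat \<Rightarrow>\<^sub>0 nat) \<Rightarrow> 'p::prime_card operation" where
  "St S R = (\<lambda>u. coefficient u S R)"

lemma St_dual:
  "(S', R') \<in> milnor_indices \<Longrightarrow>
     St S R (milnor_monomial S' R') = (if S' = S \<and> R' = R then 1 else 0)"
  by (auto simp: St_def milnor_monomial_def milnor_indices_def coefficient_monomial)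

lemma St_in_steenrod_algebra:
  assumes "(S, R) \<in> milnor_indices"
  shows "(St S R :: 'p::prime_card operation) \<in> steenrod_algebra"
proof -
  have scalar: "component (scalar c) T = (if T = {} then Poly_Mapping.single 0 c else 0)"
    for T and c :: "'p mod_ring"
    unfolding scalar_def of_pol_def by (subst Abs_extpol_inverse) auto
  have "component (scalar c * u) T = Poly_Mapping.single 0 c * component u T"
    if "finite T" for T c and u :: "'p extpol"
  proof -
    have "component (scalar c * u) T
        = (\<Sum>U\<in>Pow T. if U = {} then Poly_Mapping.single 0 c * component u T else 0)"
      unfolding component_times[OF that] by (intro sum.cong refl) (simp add: scalar)
    then show ?thesis using that by simp
  qed
  then have "St S R (scalar c * u) = c * St S R u" for c and u :: "'p extpol"
    using assms unfolding St_def coefficient_def milnor_indices_def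
    by (simp add: mult_map_scale_conv_mult[symmetric] map.rep_eq when_def)
  moreover have "finite {(S', R'). (S', R') \<in> milnor_indices
      \<and> (St S R :: 'p operation) (milnor_monomial S' R') \<noteq> 0}"
    by (rule finite_subset[of _ "{(S, R)}"]) (auto simp: St_dual split: if_splits)
  ultimately show ?thesis
    by (simp add: steenrod_algebra_def) (simp add: St_def coefficient_def lookup_add)
qed

text \<open>
  The completed tensor product of \<open>H\<^sup>*(B(\<int>/p)\<^sup>n)\<close> with \<open>A(p)\<^sup>*\<close>: the function \<open>f\<close> stands for the
  formal sum of all \<open>f (S, R) \<otimes> \<tau>\<^sub>S \<xi>\<^sup>R\<close>. The product is that of a graded tensor product,
  \<open>(a \<otimes> u) (b \<otimes> v) = (-1)\<^bsup>dim u dim b\<^esup> a b \<otimes> u v\<close>.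
\<close>

type_synonym 'p tensor = "nat set \<times> (nat \<Rightarrow>\<^sub>0 nat) \<Rightarrow> 'p extpol"

definition tensor_one :: "'p::prime_card tensor" where
  "tensor_one = (\<lambda>(S, R). if S = {} \<and> R = 0 then 1 else 0)"

definition tensor_mult :: "'p::prime_card tensor \<Rightarrow> 'p tensor \<Rightarrow> 'p tensor" where
  "tensor_mult f g = (\<lambda>(S, R). \<Sum>T\<in>Pow S. \<Sum>(Q, Q')\<in>{(Q, Q'). Q + Q' = R}.
     scalar (shuffle_sign T (S - T)) * f (T, Q) * (involution ^^ card T) (g (S - T, Q')))"

text \<open>
  \<open>\<Delta>\<^sub>i\<close>; finite sequences \<open>(r\<^sub>1, \<dots>, r\<^sub>m)\<close> are extended by zeros and indexed from \<open>1\<close>.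
\<close>

definition Delta :: "nat \<Rightarrow> nat \<Rightarrow>\<^sub>0 nat" where
  "Delta i = (if i = 0 then 0 else Poly_Mapping.single i 1)"

text \<open>
  The coaction \<open>\<lambda>\<close> of \<open>A(p)\<^sup>*\<close> on cohomology is the algebra homomorphism given by the formulas
  through which Milnor introduces the \<open>\<tau>\<^sub>s\<close> and \<open>\<xi>\<^sub>j\<close>:
  \<open>\<lambda>(x\<^sub>i) = x\<^sub>i \<otimes> 1 + \<Sum>\<^bsub>s \<ge> 0\<^esub> y\<^sub>i\<^bsup>p^s\<^esup> \<otimes> \<tau>\<^sub>s\<close> and
  \<open>\<lambda>(y\<^sub>i) = \<Sum>\<^bsub>j \<ge> 0\<^esub> y\<^sub>i\<^bsup>p^j\<^esup> \<otimes> \<xi>\<^sub>j\<close> with \<open>\<xi>\<^sub>0 = 1\<close>.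
  The index sets of the sums below have at most one element.
\<close>

definition coaction_x :: "nat \<Rightarrow> 'p::prime_card tensor" where
  "coaction_x i = (\<lambda>(S, R).
     (if S = {} \<and> R = 0 then gen_x i else 0)
     + (\<Sum>s | S = {s} \<and> R = 0. of_pol (gen_y i ^ (CARD('p) ^ s))))"

definition coaction_y :: "nat \<Rightarrow> 'p::prime_card tensor" where
  "coaction_y i = (\<lambda>(S, R). \<Sum>j | S = {} \<and> R = Delta j. of_pol (gen_y i ^ (CARD('p) ^ j)))"

definition tensor_prod :: "'p::prime_card tensor list \<Rightarrow> 'p tensor" where
  "tensor_prod fs = foldr tensor_mult fs tensor_one"

definition coaction_monomial :: "nat set \<Rightarrow> (nat \<Rightarrow>\<^sub>0 nat) \<Rightarrow> 'p::prime_card tensor" where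
  "coaction_monomial I e = tensor_prod
     (map coaction_x (sorted_list_of_set I)
      @ concat (map (\<lambda>i. replicate (Poly_Mapping.lookup e i) (coaction_y i))
                    (sorted_list_of_set (Poly_Mapping.keys e))))"

definition coaction :: "'p::prime_card extpol \<Rightarrow> 'p tensor" where
  "coaction z = (\<lambda>SR. \<Sum>I | component z I \<noteq> 0. \<Sum>e\<in>Poly_Mapping.keys (component z I).
     scalar (coefficient z I e) * coaction_monomial I e SR)"

text \<open>
  The action of \<open>A(p)\<close>: if \<open>\<lambda>(z) = \<Sum> z\<^bsub>S,R\<^esub> \<otimes> \<tau>\<^sub>S \<xi>\<^sup>R\<close>, then
  \<open>\<theta> z = \<Sum> \<theta>(\<tau>\<^sub>S \<xi>\<^sup>R) z\<^bsub>S,R\<^esub>\<close>, a finite sum for \<open>\<theta>\<close> in \<open>A(p)\<close>.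
  In particular \<open>St {0} 0\<close> acts as the Bockstein homomorphism, \<open>x\<^sub>i \<mapsto> y\<^sub>i\<close>, and
  \<open>St {} (Poly_Mapping.single 1 r)\<close> acts as the reduced power \<open>P\<^sup>r\<close>.
\<close>

definition act :: "'p::prime_card operation \<Rightarrow> 'p extpol \<Rightarrow> 'p extpol" where
  "act \<theta> z = (\<Sum>(S, R) | (S, R) \<in> milnor_indices \<and> \<theta> (milnor_monomial S R) \<noteq> 0.
     scalar (\<theta> (milnor_monomial S R)) * coaction z (S, R))"

lemma scalar_one: "scalar 1 = 1"
  unfolding scalar_def of_pol_def one_extpol_def single_one by (rule refl)

lemma act_St: "(S, R) \<in> milnor_indices \<Longrightarrow> act (St S R) z = coaction z (S, R)"
proof -
  assume SR: "(S, R) \<in> milnor_indices"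
  have "{(S', R'). (S', R') \<in> milnor_indices \<and> (St S R :: 'a operation) (milnor_monomial S' R') \<noteq> 0}
      = {(S, R)}"
    using SR by (auto simp: St_dual split: if_splits)
  then show ?thesis by (simp add: act_def St_dual[OF SR] scalar_one)
qed


section \<open>Dickson and Mui invariants\<close>

text \<open>
  For a \<open>k\<close>-element subset \<open>I\<close> of \<open>{1..n}\<close>, \<open>arrangement n I\<close> is the list \<open>[i\<^sub>1, \<dots>, i\<^sub>n]\<close>
  listing first \<open>I\<close> and then its complement, both increasingly.
\<close>

definition arrangement :: "nat \<Rightarrow> nat set \<Rightarrow> nat list" where
  "arrangement n I = sorted_list_of_set I @ sorted_list_of_set ({1..n} - I)"

definition sigma :: "nat \<Rightarrow> nat set \<Rightarrow> nat \<Rightarrow> nat" where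
  "sigma n I = (\<lambda>j. if j \<in> {1..n} then arrangement n I ! (j - 1) else j)"

text \<open>
  \<open>bracket n k [a\<^sub>k\<^sub>+\<^sub>1, \<dots>, a\<^sub>n]\<close> is \<open>[k; a\<^sub>k\<^sub>+\<^sub>1, \<dots>, a\<^sub>n]\<close>; the matrix indices are shifted to start at \<open>0\<close>.
\<close>

definition bracket :: "nat \<Rightarrow> nat \<Rightarrow> nat list \<Rightarrow> 'p::prime_card extpol" where
  "bracket n k as = (\<Sum>I | I \<subseteq> {1..n} \<and> card I = k.
     of_int (sign (sigma n I)) * prod_list (map gen_x (sorted_list_of_set I))
     * of_pol (det (mat (n - k) (n - k)
         (\<lambda>(u, v). gen_y (arrangement n I ! (k + u)) ^ (CARD('p) ^ (as ! v))))))"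

definition bracket0 :: "nat \<Rightarrow> nat list \<Rightarrow> 'p::prime_card pol" where
  "bracket0 n as = det (mat n n (\<lambda>(u, v). gen_y (u + 1) ^ (CARD('p) ^ (as ! v))))"

definition dickson_L :: "nat \<Rightarrow> nat \<Rightarrow> 'p::prime_card pol" where
  "dickson_L n s = bracket0 n (filter (\<lambda>a. a \<noteq> s) [0..<n + 1])"

text \<open>The quotient \<open>L\<^bsub>n,s\<^esub> / L\<^bsub>n,n\<^esub>\<close>, which is a polynomial.\<close>

definition dickson_Q :: "nat \<Rightarrow> nat \<Rightarrow> 'p::prime_card pol" where
  "dickson_Q n s = (THE q. q * dickson_L n n = dickson_L n s)"

text \<open>\<open>mui_M n [u\<^sub>1, \<dots>, u\<^sub>k]\<close> is \<open>M\<^bsub>n,u1,\<dots>,uk\<^esub>\<close>, for \<open>u\<^sub>1 < \<cdots> < u\<^sub>k < n\<close>.\<close>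

definition mui_M :: "nat \<Rightarrow> nat list \<Rightarrow> 'p::prime_card extpol" where
  "mui_M n us = bracket n (length us) (filter (\<lambda>a. a \<notin> set us) [0..<n])"

end

theory Submission
  imports Defs
begin

text \<open>
  The part of the coaction without exterior factors \<open>\<tau>\<^sub>s\<close> is multiplicative, so for \<open>i \<ge> 1\<close> the
  operation \<open>St\<^bsup>\<emptyset>,\<Delta>\<^sub>i\<^esup>\<close> is a derivation with \<open>x\<^sub>m \<mapsto> 0\<close> and \<open>y\<^sub>m \<mapsto> y\<^sub>m\<^bsup>p^i\<^esup>\<close>. It kills
  \<open>p\<close>-th powers, hence acts on a determinant \<open>[k; 0, b\<^sub>2, b\<^sub>3, \<dots>]\<close> with all \<open>b\<^sub>j > 0\<close> by
  replacing the exponent \<open>0\<close> with \<open>i\<close>, and kills the determinant if no exponent is \<open>0\<close>. If \<open>i < n\<close>,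
  the new determinant has a repeated column or, for \<open>i = s\<^sub>t\<close>, is a column permutation of a Mui
  invariant. If \<open>i = n\<close>, the relation
  \<open>y\<^bsup>p^n\<^esup> = \<Sum>\<^bsub>s<n\<^esub> (-1)\<^bsup>n-1-s\<^esup> Q\<^bsub>n,s\<^esub> y\<^bsup>p^s\<^esup>\<close>, valid for every \<open>y = y\<^sub>m\<close>, reduces to the previous case.
\<close>

section \<open>Lists of exponents with omitted entries\<close>

lemma upt_split_at: "s < n \<Longrightarrow> [0..<s] @ s # [Suc s..<n] = [0..<n]"
  using upt_add_eq_append[of 0 s "n - s"] by (simp add: upt_conv_Cons)

lemma filter_neq_upt:
  assumes "s < n"
  shows "filter (\<lambda>a. a \<noteq> s) [0..<n] = [0..<s] @ [Suc s..<n]"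
proof -
  have "[0..<n] = [0..<s] @ s # [Suc s..<n]"
    using assms by (simp add: upt_split_at)
  moreover have "filter (\<lambda>a. a \<noteq> s) [0..<s] = [0..<s]" "filter (\<lambda>a. a \<noteq> s) [Suc s..<n] = [Suc s..<n]"
    by (auto simp: filter_id_conv)
  ultimately show ?thesis by simp
qed

lemma length_filter_notin_upt:
  assumes "U \<subseteq> {0..<n}"
  shows "length (filter (\<lambda>a. a \<notin> U) [0..<n]) = n - card U"
proof -
  have "length (filter (\<lambda>a. a \<notin> U) [0..<n]) = card (set (filter (\<lambda>a. a \<notin> U) [0..<n]))"
    by (rule distinct_card[symmetric]) simp
  also have "set (filter (\<lambda>a. a \<notin> U) [0..<n]) = {0..<n} - U" by auto
  also have "card \<dots> = n - card U"
    using assms by (simp add: card_Diff_subset finite_subset)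
  finally show ?thesis .
qed

section \<open>Frobenius and Moore determinants\<close>

lemma CHAR_pol: "CHAR('p::prime_card pol) = CARD('p)"
proof (rule CHAR_eqI)
  show "of_nat CARD('p) = (0 :: 'p pol)"
    by (simp flip: single_of_nat)
  fix n assume "of_nat n = (0 :: 'p pol)"
  then have "(of_nat n :: 'p mod_ring) = 0"
    by (metis single_of_nat lookup_single_eq lookup_zero)
  then show "CARD('p) dvd n"
    by (simp add: of_nat_eq_0_iff_char_dvd)
qed

lemma of_nat_card_pol: "of_nat CARD('p) = (0 :: 'p::prime_card pol)"
  by (metis CHAR_pol of_nat_CHAR)

lemma frobenius_sum_pol:
  fixes f :: "'b \<Rightarrow> 'p::prime_card pol"
  shows "sum f A ^ CARD('p) = (\<Sum>a\<in>A. f a ^ CARD('p))"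
  by (rule freshmans_dream_sum) (simp_all add: CHAR_pol prime_card)

lemma frobenius_diff_pol:
  fixes a b :: "'p::prime_card pol"
  shows "(a - b) ^ CARD('p) = a ^ CARD('p) - b ^ CARD('p)"
proof -
  have "((a - b) + b) ^ CARD('p) = (a - b) ^ CARD('p) + b ^ CARD('p)"
    by (rule freshmans_dream) (simp_all add: CHAR_pol prime_card)
  then show ?thesis by simp
qed

text \<open>
  The monic additive polynomial \<open>f\<^sub>n\<close> killing the first \<open>n\<close> elements is built by
  \<open>f\<^bsub>n+1\<^esub>(X) = f\<^sub>n(X)\<^sup>p - f\<^sub>n(g\<^sub>n)\<^bsup>p-1\<^esup> f\<^sub>n(X)\<close>.
\<close>

lemma frobenius_power_relation:
  fixes g :: "nat \<Rightarrow> 'p::prime_card pol"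
  shows "\<exists>c. \<forall>i<n. g i ^ (CARD('p) ^ n) = (\<Sum>s<n. c s * g i ^ (CARD('p) ^ s))"
proof (induction n)
  case 0
  show ?case by simp
next
  case (Suc n)
  let ?q = "CARD('p)"
  obtain c where c: "\<And>i. i < n \<Longrightarrow> g i ^ (?q ^ n) = (\<Sum>s<n. c s * g i ^ (?q ^ s))"
    using Suc by blast
  define f where "f = (\<lambda>x. x ^ (?q ^ n) - (\<Sum>s<n. c s * x ^ (?q ^ s)))"
  define a where "a = f (g n)"
  \<comment> \<open>\<open>d\<close> collects the lower coefficients of f_{n+1} with reversed sign:
    c_{s-1}^p comes from f_n(X)^p, and the multiples of a^{p-1} come from the correction
    term.\<close>
  define d where "d = (\<lambda>s. (if s = 0 then 0 else c (s - 1) ^ ?q)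
                      + a ^ (?q - 1) * (if s = n then 1 else - c s))"
  have fq: "f x ^ ?q = x ^ (?q ^ Suc n) - (\<Sum>s<n. c s ^ ?q * x ^ (?q ^ Suc s))" for x
    unfolding f_def frobenius_diff_pol frobenius_sum_pol
    by (simp add: power_mult_distrib mult.commute flip: power_mult)
  have 1: "(\<Sum>s<Suc n. (if s = 0 then 0 else c (s - 1) ^ ?q) * x ^ (?q ^ s))
      = (\<Sum>s<n. c s ^ ?q * x ^ (?q ^ Suc s))" for x
    by (subst sum.lessThan_Suc_shift) simp
  have 2: "(\<Sum>s<Suc n. (if s = n then 1 else - c s) * x ^ (?q ^ s)) = f x" for x
    by (simp add: f_def sum_negf)
  have "(\<Sum>s<Suc n. d s * x ^ (?q ^ s)) = (\<Sum>s<n. c s ^ ?q * x ^ (?q ^ Suc s)) + a ^ (?q - 1) * f x" for x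
    unfolding 1[symmetric] 2[symmetric] d_def
    by (simp only: distrib_right sum.distrib sum_distrib_left mult.assoc)
  then have d: "(\<Sum>s<Suc n. d s * x ^ (?q ^ s)) = x ^ (?q ^ Suc n) - f x ^ ?q + a ^ (?q - 1) * f x" for x
    unfolding fq by simp
  \<comment> \<open>This says f_{n+1}(g_i) = 0. For i < n already f_n(g_i) = 0; for i = n both sides
    are a^p, which is why the factor a^{p-1} was chosen.\<close>
  have "f (g i) ^ ?q = a ^ (?q - 1) * f (g i)" if "i < Suc n" for i
  proof (cases "i = n")
    case True
    then show ?thesis by (simp add: a_def power_minus_mult del: One_nat_def)
  next
    case False
    then have "f (g i) = 0" using that c by (simp add: f_def)
    then show ?thesis by simp
  qed
  then have "\<forall>i<Suc n. g i ^ (?q ^ Suc n) = (\<Sum>s<Suc n. d s * g i ^ (?q ^ s))"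
    unfolding d by simp
  then show ?case by blast
qed

text \<open>The row elements are left free because \<open>bracket0\<close> uses y_1, ..., y_n, while
  each component of a \<open>bracket\<close> uses the y's listed by \<open>arrangement\<close> from
  position \<open>k\<close> on.\<close>

definition moore :: "(nat \<Rightarrow> 'p::prime_card pol) \<Rightarrow> nat list \<Rightarrow> 'p pol" where
  "moore g as = det (mat (length as) (length as) (\<lambda>(u, v). g u ^ (CARD('p) ^ (as ! v))))"

lemma moore_not_distinct: "\<not> distinct as \<Longrightarrow> moore g as = 0"
proof -
  assume "\<not> distinct as"
  then obtain v w where "v < length as" "w < length as" "v \<noteq> w" "as ! v = as ! w"
    by (auto simp: distinct_conv_nth)
  then show ?thesis
    unfolding moore_def
    by (intro det_identical_columns[of _ "length as" v w]) (auto intro!: eq_vecI)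
qed

lemma moore_swap: "moore g (xs @ a # b # ys) = - moore g (xs @ b # a # ys)"
proof -
  define n where "n = length (xs @ b # a # ys)"
  let ?k = "length xs"
  let ?M = "mat n n (\<lambda>(u, v). g u ^ (CARD('a) ^ ((xs @ b # a # ys) ! v)))"
  have "mat n n (\<lambda>(u, v). g u ^ (CARD('a) ^ ((xs @ a # b # ys) ! v))) = swapcols ?k (Suc ?k) ?M"
    by (rule eq_matI) (auto simp: n_def nth_append nth_Cons' not_less split: if_splits)
  moreover have "det (swapcols ?k (Suc ?k) ?M) = - det ?M"
    by (rule det_swapcols[of _ n]) (auto simp: n_def)
  ultimately show ?thesis by (simp add: moore_def n_def)
qed

lemma moore_move: "moore g (xs @ a # cs @ ds) = (-1) ^ length cs * moore g (xs @ cs @ a # ds)"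
proof (induction cs arbitrary: xs)
  case (Cons c cs)
  \<comment> \<open>One transposition moves \<open>c\<close> into the prefix, so the induction
    hypothesis is taken for \<open>xs @ [c]\<close>.\<close>
  show ?case using Cons[of "xs @ [c]"] by (simp add: moore_swap[of g xs a c])
qed simp

text \<open>The Leibniz formula uses ring operations only. The intended \<open>K\<close> is the
  kernel of \<open>milnor_deriv i\<close>: a determinant whose entries the derivation kills is
  killed too.\<close>

lemma det_in_subring:
  fixes K :: "'a::comm_ring_1 set"
  assumes "\<And>u v. u < n \<Longrightarrow> v < n \<Longrightarrow> F (u, v) \<in> K"
    and add: "\<And>x y. x \<in> K \<Longrightarrow> y \<in> K \<Longrightarrow> x + y \<in> K"
    and mult: "\<And>x y. x \<in> K \<Longrightarrow> y \<in> K \<Longrightarrow> x * y \<in> K"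
    and const: "0 \<in> K" "1 \<in> K" "- 1 \<in> K"
  shows "det (mat n n F) \<in> K"
proof -
  have K_prod: "prod f A \<in> K" if "\<And>x. x \<in> A \<Longrightarrow> f x \<in> K" for f and A :: "nat set"
    using that by (induction A rule: infinite_finite_induct) (auto simp: const mult)
  have K_sum: "sum f A \<in> K" if "\<And>x. x \<in> A \<Longrightarrow> f x \<in> K" for f and A :: "(nat \<Rightarrow> nat) set"
    using that by (induction A rule: infinite_finite_induct) (auto simp: const add)
  have "signof p \<in> K" for p :: "nat \<Rightarrow> nat"
    by (simp add: sign_def const)
  moreover have "mat n n F $$ (i, p i) \<in> K" if "p permutes {0..<n}" "i < n" for p i
    using that assms(1)[of i "p i"] permutes_in_image[OF that(1), of i] by simp
  ultimately show ?thesis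
    unfolding det_def'[OF mat_carrier] by (auto intro!: K_sum mult K_prod simp del: index_mat)
qed

text \<open>Laplace expansion. The cofactors see only the columns of \<open>bs\<close>, so one
  family \<open>C\<close> serves every first exponent \<open>a\<close>. \<open>K = UNIV\<close>
  gives linearity in the first column; for \<open>K\<close> the kernel of a derivation, the
  cofactors are constants.\<close>

lemma moore_first_column:
  assumes "\<And>u b. b \<in> set bs \<Longrightarrow> g u ^ (CARD('p) ^ b) \<in> K"
    and "\<And>x y. x \<in> K \<Longrightarrow> y \<in> K \<Longrightarrow> x + y \<in> K"
    and "\<And>x y. x \<in> K \<Longrightarrow> y \<in> K \<Longrightarrow> x * y \<in> K"
    and "0 \<in> K" "1 \<in> K" "- 1 \<in> K"
  obtains C :: "nat \<Rightarrow> 'p::prime_card pol"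
  where "\<And>a. moore g (a # bs) = (\<Sum>u<Suc (length bs). g u ^ (CARD('p) ^ a) * C u)"
    and "\<And>u. C u \<in> K"
proof
  define n where "n = Suc (length bs)"
  let ?M = "\<lambda>a. mat n n (\<lambda>(u, v). g u ^ (CARD('p) ^ ((a # bs) ! v)))"
  let ?m = "\<lambda>u. mat (n - 1) (n - 1) (\<lambda>(i, v). g (if i < u then i else Suc i) ^ (CARD('p) ^ (bs ! v)))"
  let ?C = "\<lambda>u. (-1) ^ u * det (?m u)"
  have cof: "cofactor (?M a) u 0 = ?C u" if "u < n" for a u
  proof -
    have "mat_delete (?M a) u 0 = ?m u"
      by (rule eq_matI) (use that in \<open>auto simp: mat_delete_def\<close>)
    then show ?thesis unfolding cofactor_def by simp
  qed
  show "moore g (a # bs) = (\<Sum>u<Suc (length bs). g u ^ (CARD('p) ^ a) * ?C u)" for a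
  proof -
    have "moore g (a # bs) = (\<Sum>u<n. ?M a $$ (u, 0) * cofactor (?M a) u 0)"
      unfolding moore_def by (subst laplace_expansion_column[of _ n 0]) (auto simp: n_def)
    also have "\<dots> = (\<Sum>u<n. g u ^ (CARD('p) ^ a) * ?C u)"
    proof (intro sum.cong refl)
      fix u assume "u \<in> {..<n}"
      then have "u < n" "0 < n" by auto
      then show "?M a $$ (u, 0) * cofactor (?M a) u 0 = g u ^ (CARD('p) ^ a) * ?C u"
        unfolding cof[OF \<open>u < n\<close>] by simp
    qed
    finally show ?thesis unfolding n_def .
  qed
  have "(-1) ^ m \<in> K" for m by (induction m) (simp_all only: power_0 power_Suc assms)
  then show "?C u \<in> K" for u
    by (intro assms(3) det_in_subring[where K = K]) (use assms in \<open>auto simp: n_def\<close>)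
qed

text \<open>All rows satisfy the relation with the same coefficients, so the first column is a
  linear combination of the columns with exponents below \<open>n\<close>.\<close>

lemma moore_expand_first:
  fixes g :: "nat \<Rightarrow> 'p::prime_card pol"
  assumes "\<And>u. u \<le> length bs \<Longrightarrow> g u ^ (CARD('p) ^ n) = (\<Sum>s<n. d s * g u ^ (CARD('p) ^ s))"
  shows "moore g (n # bs) = (\<Sum>s<n. d s * moore g (s # bs))"
proof -
  obtain C :: "nat \<Rightarrow> 'p pol"
    where C: "\<And>a. moore g (a # bs) = (\<Sum>u<Suc (length bs). g u ^ (CARD('p) ^ a) * C u)"
    by (rule moore_first_column[where K = UNIV and g = g and bs = bs]) auto
  have "moore g (n # bs) = (\<Sum>u<Suc (length bs). \<Sum>s<n. d s * (g u ^ (CARD('p) ^ s) * C u))"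
    unfolding C by (intro sum.cong refl) (simp add: assms sum_distrib_right mult.assoc)
  also have "\<dots> = (\<Sum>s<n. \<Sum>u<Suc (length bs). d s * (g u ^ (CARD('p) ^ s) * C u))"
    by (rule sum.swap)
  finally show ?thesis unfolding C by (simp only: sum_distrib_left)
qed

section \<open>Nonvanishing of the Moore determinant of distinct variables\<close>

lemma gen_y_power: "gen_y m ^ r = Poly_Mapping.single (Poly_Mapping.single m r) (1 :: 'p::prime_card mod_ring)"
  by (induction r) (simp_all add: gen_y_def mult_single flip: single_add)

lemma prod_single_pol:
  "(\<Prod>j\<in>A. Poly_Mapping.single (f j) (1 :: 'p::prime_card mod_ring))
   = Poly_Mapping.single (\<Sum>j\<in>A. f j :: nat \<Rightarrow>\<^sub>0 nat) 1"
  by (induction A rule: infinite_finite_induct) (simp_all add: mult_single)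

lemma lookup_sum_single_inj:
  assumes "finite A" "inj_on f A" "j \<in> A"
  shows "Poly_Mapping.lookup (\<Sum>j\<in>A. Poly_Mapping.single (f j) (c j)) (f j) = c j"
proof -
  have "(\<Sum>i\<in>A. Poly_Mapping.lookup (Poly_Mapping.single (f i) (c i)) (f j))
      = (\<Sum>i\<in>A. if i = j then c j else 0)"
    using assms by (intro sum.cong refl) (auto simp: lookup_single when_def inj_on_def)
  then show ?thesis using assms by (simp add: lookup_sum)
qed

text \<open>Every permutation contributes one signed monomial to the Leibniz expansion. The diagonal
  monomial arises from the identity alone, so its coefficient is 1.\<close>

lemma moore_nonzero:
  assumes "inj \<rho>"
  shows "moore (\<lambda>u. gen_y (\<rho> u)) [0..<n] \<noteq> (0 :: 'p::prime_card pol)"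
proof -
  let ?q = "CARD('p)"
  define e where "e = (\<lambda>\<pi>. \<Sum>j<n. Poly_Mapping.single (\<rho> (\<pi> j)) (?q ^ j))"
  have q: "1 < ?q" using prime_card[where 'a = 'p] prime_gt_1_nat by blast
  have det: "moore (\<lambda>u. gen_y (\<rho> u)) [0..<n]
      = (\<Sum>\<pi> | \<pi> permutes {0..<n}. signof \<pi> * Poly_Mapping.single (e \<pi>) (1 :: 'p mod_ring))"
    unfolding moore_def length_upt diff_zero det_col[OF mat_carrier]
  proof (intro sum.cong refl arg_cong2[where f = "(*)"])
    fix \<pi> assume "\<pi> \<in> {\<pi>. \<pi> permutes {0..<n}}"
    then have \<pi>: "\<pi> permutes {0..<n}" by simp
    have "(\<Prod>j<n. mat n n (\<lambda>(u, v). gen_y (\<rho> u) ^ ?q ^ ([0..<n] ! v)) $$ (\<pi> j, j))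
        = (\<Prod>j<n. Poly_Mapping.single (Poly_Mapping.single (\<rho> (\<pi> j)) (?q ^ j)) (1 :: 'p mod_ring))"
      using permutes_in_image[OF \<pi>] by (intro prod.cong refl) (simp add: gen_y_power)
    then show "(\<Prod>j<n. mat n n (\<lambda>(u, v). gen_y (\<rho> u) ^ ?q ^ ([0..<n] ! v)) $$ (\<pi> j, j))
        = Poly_Mapping.single (e \<pi>) (1 :: 'p mod_ring)"
      by (simp add: prod_single_pol e_def)
  qed
  \<comment> \<open>The variable with index \<open>\<rho> (\<pi> j)\<close> has exponent p^j in
    \<open>e \<pi>\<close> and p^(\<pi> j) in \<open>e id\<close>; as p > 1, equality forces
    \<open>\<pi> j = j\<close>.\<close>
  have e_inj: "\<pi> = id" if \<pi>: "\<pi> permutes {0..<n}" and "e \<pi> = e id" for \<pi>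
  proof
    fix j
    show "\<pi> j = id j"
    proof (cases "j < n")
      case True
      have inj: "inj_on (\<lambda>j. \<rho> (\<pi> j)) {..<n}"
        using inj_compose[OF assms permutes_inj[OF \<pi>]] by (simp add: comp_def inj_on_def)
      have "?q ^ j = Poly_Mapping.lookup (e \<pi>) (\<rho> (\<pi> j))"
        unfolding e_def by (rule lookup_sum_single_inj[OF _ inj, symmetric]) (use True in auto)
      also have "\<dots> = Poly_Mapping.lookup (e id) (\<rho> (\<pi> j))" using that by simp
      also have "\<dots> = ?q ^ \<pi> j"
        unfolding e_def id_apply
        by (rule lookup_sum_single_inj)
          (use True assms permutes_in_image[OF \<pi>] in \<open>auto simp: inj_on_def\<close>)
      finally show ?thesis using q by simp
    next
      case False
      then show ?thesis using \<pi> by (simp add: permutes_def)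
    qed
  qed
  have "Poly_Mapping.lookup (signof \<pi> * Poly_Mapping.single (e \<pi>) (1 :: 'p mod_ring)) (e id)
      = (if \<pi> = id then 1 else 0)" if "\<pi> permutes {0..<n}" for \<pi>
    using e_inj[OF that] by (auto simp: sign_def lookup_single when_def)
  then have "Poly_Mapping.lookup (moore (\<lambda>u. gen_y (\<rho> u)) [0..<n]) (e id)
      = (\<Sum>\<pi> | \<pi> permutes {0..<n}. if \<pi> = id then 1 else (0 :: 'p mod_ring))"
    unfolding det lookup_sum by (intro sum.cong refl) simp
  also have "\<dots> = 1"
    by (simp add: finite_permutations permutes_id)
  finally show ?thesis by auto
qed

section \<open>Dickson invariants\<close>

lemma bracket0_eq_moore: "length as = n \<Longrightarrow> bracket0 n as = moore (\<lambda>u. gen_y (Suc u)) as"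
  by (simp add: bracket0_def moore_def)

text \<open>Cramer's rule. Substituting the relation of \<open>frobenius_power_relation\<close> into
  the column with exponent n of L_{n,s} leaves d_s L_n up to sign. This also shows that L_n divides
  L_{n,s}.\<close>

lemma dickson_power_relation:
  obtains d :: "nat \<Rightarrow> 'p::prime_card pol"
  where "\<And>i. 1 \<le> i \<Longrightarrow> i \<le> n \<Longrightarrow> gen_y i ^ (CARD('p) ^ n) = (\<Sum>s<n. d s * gen_y i ^ (CARD('p) ^ s))"
    and "\<And>s. s < n \<Longrightarrow> d s = (-1) ^ (n - 1 - s) * dickson_Q n s"
proof -
  let ?q = "CARD('p)"
  let ?g = "\<lambda>u. gen_y (Suc u) :: 'p pol"
  obtain d where d: "\<And>i. i < n \<Longrightarrow> ?g i ^ (?q ^ n) = (\<Sum>s<n. d s * ?g i ^ (?q ^ s))"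
    using frobenius_power_relation[of n ?g] by blast
  have "d s = (-1) ^ (n - 1 - s) * dickson_Q n s" if s: "s < n" for s
  proof -
    let ?r = "[0..<s] @ [Suc s..<n]"
    have L: "dickson_L n n = moore ?g [0..<n]"
      unfolding dickson_L_def by (subst bracket0_eq_moore) (simp_all add: filter_neq_upt)
    have "L \<noteq> 0" if "L = dickson_L n n" for L :: "'p pol"
      unfolding that L by (rule moore_nonzero) (simp add: inj_def)
    then have L0: "dickson_L n n \<noteq> (0 :: 'p pol)" by blast
    have "dickson_L n s = moore ?g (?r @ [n])"
      unfolding dickson_L_def by (subst bracket0_eq_moore) (use s in \<open>simp_all add: filter_neq_upt\<close>)
    also have "\<dots> = (-1) ^ (n - 1) * moore ?g (n # ?r)"
      using moore_move[of ?g "[]" n ?r "[]"] s by (simp flip: mult.assoc power_add)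
    also have "moore ?g (n # ?r) = (\<Sum>t<n. d t * moore ?g (t # ?r))"
      by (rule moore_expand_first) (use s d in auto)
    \<comment> \<open>Every t < n other than s already occurs in \<open>?r\<close>, so its
      determinant has a repeated column.\<close>
    also have "\<dots> = (\<Sum>t<n. if t = s then d s * moore ?g (s # ?r) else 0)"
    proof (intro sum.cong refl)
      fix t assume "t \<in> {..<n}"
      then have "t \<noteq> s \<Longrightarrow> \<not> distinct (t # ?r)" by auto
      then show "d t * moore ?g (t # ?r) = (if t = s then d s * moore ?g (s # ?r) else 0)"
        using moore_not_distinct[of "t # ?r" ?g] by simp
    qed
    also have "\<dots> = d s * moore ?g (s # ?r)" using s by simp
    also have "moore ?g (s # ?r) = (-1) ^ s * moore ?g [0..<n]"
      using moore_move[of ?g "[]" s "[0..<s]" "[Suc s..<n]"] by (simp add: upt_split_at[OF s])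
    also have "(-1) ^ (n - 1) * (d s * ((-1) ^ s * moore ?g [0..<n]))
        = ((-1) ^ (n - 1 - s) * d s) * dickson_L n n"
    proof -
      have "n - 1 = (n - 1 - s) + s" using s by simp
      then have "(-1 :: 'p pol) ^ (n - 1) = (-1) ^ (n - 1 - s) * (-1) ^ s" by (metis power_add)
      then show ?thesis unfolding L
        by (simp add: mult_ac)
    qed
    finally have "((-1) ^ (n - 1 - s) * d s) * dickson_L n n = dickson_L n s" ..
    \<comment> \<open>The quotient exists by the equation just found and is unique because L_n is a
      nonzero element of a domain; both are needed to evaluate \<open>THE\<close>.\<close>
    with L0 have "dickson_Q n s = (-1) ^ (n - 1 - s) * d s"
      unfolding dickson_Q_def by (intro the_equality) (auto, metis mult_cancel_right)
    then show ?thesis by (simp flip: mult.assoc power_add)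
  qed
  moreover have "gen_y i ^ (?q ^ n) = (\<Sum>s<n. d s * gen_y i ^ (?q ^ s))" if "1 \<le> i" "i \<le> n" for i
    using d[of "i - 1"] that by simp
  ultimately show ?thesis using that by blast
qed

section \<open>The derivation on polynomials\<close>

text \<open>A monomial is treated as the list of its variables with repetition, the form in which
  \<open>coaction_monomial\<close> multiplies their coactions. The recursion is the Leibniz rule for
  y_m \<mapsto> y_m^(p^i).\<close>

fun word_deriv :: "nat \<Rightarrow> nat list \<Rightarrow> 'p::prime_card pol" where
  "word_deriv i [] = 0"
| "word_deriv i (m # ms) = gen_y m * word_deriv i ms + gen_y m ^ (CARD('p) ^ i) * prod_list (map gen_y ms)"

lemma word_deriv_append:
  "word_deriv i (xs @ ys) = prod_list (map gen_y xs) * word_deriv i ys + word_deriv i xs * prod_list (map gen_y ys)"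
  by (induction xs) (simp_all add: algebra_simps)

text \<open>Needed because multiplying monomials concatenates their words, and the result is not in
  the sorted order of \<open>monomial_word\<close>. By commutativity any letter can be brought to
  the front.\<close>

lemma word_deriv_mset:
  "mset xs = mset ys \<Longrightarrow> word_deriv i xs = (word_deriv i ys :: 'p::prime_card pol)"
proof (induction xs arbitrary: ys)
  case (Cons x xs)
  then have "x \<in> set ys" by (metis list.set_intros(1) set_mset_mset)
  then obtain as bs where ys: "ys = as @ x # bs" by (meson split_list)
  then have ms: "mset xs = mset (as @ bs)" using Cons.prems by simp
  then have "word_deriv i xs = (word_deriv i (as @ bs) :: 'p pol)" by (rule Cons.IH)
  moreover have "prod_list (map gen_y xs) = (prod_list (map gen_y (as @ bs)) :: 'p pol)"
    using ms by (metis mset_map prod_mset_prod_list)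
  ultimately show ?case by (simp add: ys word_deriv_append algebra_simps)
qed simp

text \<open>Chosen so that mapping \<open>coaction_y\<close> over it gives exactly the polynomial
  part of the list in \<open>coaction_monomial\<close>.\<close>

definition monomial_word :: "(nat \<Rightarrow>\<^sub>0 nat) \<Rightarrow> nat list" where
  "monomial_word e = concat (map (\<lambda>i. replicate (Poly_Mapping.lookup e i) i)
     (sorted_list_of_set (Poly_Mapping.keys e)))"

lemma count_monomial_word: "count (mset (monomial_word e)) m = Poly_Mapping.lookup e m"
proof -
  have *: "count (mset (concat (map (\<lambda>i. replicate (Poly_Mapping.lookup e i) i) xs))) m
      = (if m \<in> set xs then Poly_Mapping.lookup e m else 0)" if "distinct xs" for xs
    using that by (induction xs) auto
  show ?thesis
    unfolding monomial_word_def by (subst *) (auto simp: in_keys_iff)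
qed

lemma mset_monomial_word_add:
  "mset (monomial_word (e + e')) = mset (monomial_word e @ monomial_word e')"
  by (rule multiset_eqI) (simp only: count_monomial_word lookup_add mset_append plus_multiset.rep_eq)

lemma prod_list_gen_y:
  "prod_list (map gen_y ws)
   = Poly_Mapping.single (\<Sum>m\<leftarrow>ws. Poly_Mapping.single m 1) (1 :: 'p::prime_card mod_ring)"
  by (induction ws) (simp_all add: gen_y_def mult_single)

lemma lookup_sum_list_single:
  "Poly_Mapping.lookup (\<Sum>m\<leftarrow>ws. Poly_Mapping.single m (1::nat)) k = count (mset ws) k"
  by (induction ws) (simp_all add: lookup_add lookup_single when_def)

lemma prod_monomial_word:
  "prod_list (map gen_y (monomial_word e)) = Poly_Mapping.single e (1 :: 'p::prime_card mod_ring)"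
proof -
  have "(\<Sum>m\<leftarrow>monomial_word e. Poly_Mapping.single m (1::nat)) = e"
    by (rule poly_mapping_eqI) (simp only: lookup_sum_list_single count_monomial_word)
  then show ?thesis by (simp only: prod_list_gen_y)
qed

text \<open>The restriction of \<open>St\<^bsup>\<emptyset>,\<Delta>\<^sub>i\<^esup>\<close>, \<open>i \<ge> 1\<close>, to polynomials.\<close>

definition milnor_deriv :: "nat \<Rightarrow> 'p::prime_card pol \<Rightarrow> 'p pol" where
  "milnor_deriv i q = (\<Sum>e\<in>Poly_Mapping.keys q.
     Poly_Mapping.single 0 (Poly_Mapping.lookup q e) * word_deriv i (monomial_word e))"

lemma milnor_deriv_add: "milnor_deriv i (q + r) = milnor_deriv i q + milnor_deriv i r"
  unfolding milnor_deriv_def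
  by (rule setsum_keys_plus_distrib) (simp_all add: single_add distrib_right)

lemma milnor_deriv_zero [simp]: "milnor_deriv i 0 = 0"
  by (simp add: milnor_deriv_def)

lemma milnor_deriv_sum: "milnor_deriv i (sum f A) = (\<Sum>a\<in>A. milnor_deriv i (f a))"
  by (induction A rule: infinite_finite_induct) (simp_all add: milnor_deriv_add)

lemma milnor_deriv_single:
  "milnor_deriv i (Poly_Mapping.single e c) = Poly_Mapping.single 0 c * word_deriv i (monomial_word e)"
  by (simp add: milnor_deriv_def)

lemma poly_mapping_sum_single:
  fixes q :: "'a \<Rightarrow>\<^sub>0 'b::comm_monoid_add"
  shows "q = (\<Sum>e\<in>Poly_Mapping.keys q. Poly_Mapping.single e (Poly_Mapping.lookup q e))"
proof (rule poly_mapping_eqI)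
  fix k
  show "Poly_Mapping.lookup q k
      = Poly_Mapping.lookup (\<Sum>e\<in>Poly_Mapping.keys q. Poly_Mapping.single e (Poly_Mapping.lookup q e)) k"
    by (cases "k \<in> Poly_Mapping.keys q") (simp_all add: lookup_sum lookup_single when_def in_keys_iff)
qed

text \<open>On monomials this is the rule for concatenated words; the general case follows by
  bilinearity from the expansions of \<open>q\<close> and \<open>r\<close> into monomials.\<close>

lemma milnor_deriv_mult:
  fixes q r :: "'p::prime_card pol"
  shows "milnor_deriv i (q * r) = q * milnor_deriv i r + milnor_deriv i q * r"
proof -
  have single: "milnor_deriv i (Poly_Mapping.single e c * Poly_Mapping.single e' c')
      = Poly_Mapping.single e c * milnor_deriv i (Poly_Mapping.single e' c')
        + milnor_deriv i (Poly_Mapping.single e c) * Poly_Mapping.single e' (c' :: 'p mod_ring)"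
    for e e' c c'
  proof -
    have 1: "word_deriv i (monomial_word (e + e')) = Poly_Mapping.single e 1 * word_deriv i (monomial_word e')
        + word_deriv i (monomial_word e) * Poly_Mapping.single e' (1 :: 'p mod_ring)"
      unfolding word_deriv_mset[OF mset_monomial_word_add] word_deriv_append prod_monomial_word ..
    have 2: "Poly_Mapping.single e c = Poly_Mapping.single 0 c * Poly_Mapping.single e 1"
      for e :: "nat \<Rightarrow>\<^sub>0 nat" and c :: "'p mod_ring"
      by (simp add: mult_single)
    have 3: "Poly_Mapping.single 0 (c * c') = Poly_Mapping.single 0 c * Poly_Mapping.single 0 c'"
      by (simp add: mult_single)
    show ?thesis
      unfolding mult_single[of e c e' c'] milnor_deriv_single 1 3
      unfolding 2[of e c] 2[of e' c'] by (simp only: algebra_simps)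
  qed
  have "milnor_deriv i ((\<Sum>e\<in>A. Poly_Mapping.single e (f e)) * (\<Sum>e\<in>B. Poly_Mapping.single e (g e)))
      = (\<Sum>e\<in>A. Poly_Mapping.single e (f e)) * milnor_deriv i (\<Sum>e\<in>B. Poly_Mapping.single e (g e))
        + milnor_deriv i (\<Sum>e\<in>A. Poly_Mapping.single e (f e)) * (\<Sum>e\<in>B. Poly_Mapping.single e (g e :: 'p mod_ring))"
    for A B f g
    by (simp only: sum_product milnor_deriv_sum single sum.distrib)
  from this[of "Poly_Mapping.lookup q" "Poly_Mapping.keys q" "Poly_Mapping.lookup r" "Poly_Mapping.keys r"]
  show ?thesis unfolding poly_mapping_sum_single[symmetric] .
qed

lemma milnor_deriv_gen_y: "milnor_deriv i (gen_y m) = (gen_y m ^ (CARD('p) ^ i) :: 'p::prime_card pol)"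
proof -
  have "mset (monomial_word (Poly_Mapping.single m 1)) = mset [m]"
    by (rule multiset_eqI) (simp add: count_monomial_word lookup_single when_def)
  then have "word_deriv i (monomial_word (Poly_Mapping.single m 1)) = (word_deriv i [m] :: 'p pol)"
    by (rule word_deriv_mset)
  then show ?thesis by (simp add: gen_y_def milnor_deriv_single)
qed

lemma milnor_deriv_one [simp]: "milnor_deriv i 1 = 0"
  using milnor_deriv_mult[of i 1 1] by (metis add_cancel_right_right mult_1_left mult_1_right)

lemma milnor_deriv_minus_one: "milnor_deriv i (- 1) = 0"
  using milnor_deriv_add[of i 1 "- 1"] by simp

lemma milnor_deriv_power: "milnor_deriv i (q ^ n) = of_nat n * q ^ (n - 1) * milnor_deriv i q"
proof (induction n)
  case (Suc n)
  then show ?case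
    by (cases n) (simp_all add: milnor_deriv_mult algebra_simps)
qed simp

text \<open>The power rule produces the factor p^b, which is 0 in characteristic p once b >
  0.\<close>

lemma milnor_deriv_frobenius_power: "0 < b \<Longrightarrow> milnor_deriv i (q ^ (CARD('p) ^ b)) = (0 :: 'p::prime_card pol)"
  by (simp add: milnor_deriv_power of_nat_card_pol)

lemma milnor_deriv_moore_positive:
  assumes "\<And>b. b \<in> set bs \<Longrightarrow> 0 < b"
  shows "milnor_deriv i (moore g bs) = 0"
proof -
  have "moore g bs \<in> {q. milnor_deriv i q = 0}"
    unfolding moore_def
    by (rule det_in_subring)
      (use assms in \<open>auto simp: milnor_deriv_add milnor_deriv_mult milnor_deriv_minus_one
        milnor_deriv_frobenius_power\<close>)
  then show ?thesis by simp
qed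

text \<open>In the expansion along the first column the cofactors are constants for the derivation,
  which therefore acts only on the entries y of that column and turns them into y^(p^i). The rows
  must be generators, since only there is the derivation given by this formula.\<close>

lemma milnor_deriv_moore_zero:
  assumes "\<And>b. b \<in> set bs \<Longrightarrow> 0 < b"
  shows "milnor_deriv i (moore (\<lambda>u. gen_y (\<rho> u)) (0 # bs)) = (moore (\<lambda>u. gen_y (\<rho> u)) (i # bs) :: 'p::prime_card pol)"
proof -
  let ?g = "\<lambda>u. gen_y (\<rho> u) :: 'p pol"
  obtain C :: "nat \<Rightarrow> 'p pol"
    where C: "\<And>a. moore ?g (a # bs) = (\<Sum>u<Suc (length bs). ?g u ^ (CARD('p) ^ a) * C u)"
      and "\<And>u. C u \<in> {q. milnor_deriv i q = 0}"
    by (rule moore_first_column[where K = "{q. milnor_deriv i q = 0}" and g = ?g and bs = bs])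
      (use assms in \<open>auto simp: milnor_deriv_add milnor_deriv_mult milnor_deriv_minus_one
        milnor_deriv_frobenius_power\<close>)
  then show ?thesis
    by (simp only: C milnor_deriv_sum milnor_deriv_mult milnor_deriv_gen_y power_0 power_one_right
        mem_Collect_eq mult_zero_right add_0)
qed

section \<open>The coaction modulo the exterior generators\<close>

lemma component_sum: "component (sum f A) S = (\<Sum>a\<in>A. component (f a) S)"
  by (induction A rule: infinite_finite_induct) simp_all

lemma component_of_pol: "component (of_pol q) S = (if S = {} then q else 0)"
  unfolding of_pol_def by (subst Abs_extpol_inverse) auto

lemma component_times_of_pol: "component (z * of_pol q) S = component z S * q"
proof (cases "finite S")
  case True
  have "component (z * of_pol q) S = (\<Sum>T\<in>Pow S. if T = S then component z S * q else 0)"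
    unfolding component_times[OF True] by (intro sum.cong refl) (auto simp: component_of_pol)
  then show ?thesis using True by simp
qed (simp add: component_infinite)

lemma component_of_pol_times: "component (of_pol q * z) S = q * component z S"
proof (cases "finite S")
  case True
  have "component (of_pol q * z) S = (\<Sum>T\<in>Pow S. if T = {} then q * component z S else 0)"
    unfolding component_times[OF True] by (intro sum.cong refl) (auto simp: component_of_pol)
  then show ?thesis using True by simp
qed (simp add: component_infinite)

lemma component_minus_one_power_times: "component ((-1) ^ m * z) S = (-1) ^ m * component z S"
  by (induction m) (simp_all add: mult.assoc)

lemma component_sign_times: "component (of_int (sign \<pi>) * z) S = of_int (sign \<pi>) * component z S"
  by (simp add: sign_def)

lemma of_pol_zero [simp]: "of_pol 0 = 0"
  by (rule extpol_eqI) (simp add: component_of_pol)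

lemma of_pol_one [simp]: "of_pol 1 = 1"
  by (rule extpol_eqI) (simp add: component_of_pol component_one)

lemma of_pol_add: "of_pol (q + r) = of_pol q + of_pol r"
  by (rule extpol_eqI) (simp add: component_of_pol)

lemma of_pol_mult: "of_pol (q * r) = of_pol q * of_pol r"
  by (rule extpol_eqI) (simp add: component_of_pol_times component_of_pol)

lemma component_monomial:
  "finite T \<Longrightarrow> component (monomial T R) S = (if S = T then Poly_Mapping.single R 1 else 0)"
  unfolding monomial_def by (subst Abs_extpol_inverse) auto

lemma prod_list_gen_x:
  "sorted_wrt (<) xs \<Longrightarrow> prod_list (map gen_x xs) = (monomial (set xs) 0 :: 'p::prime_card extpol)"
proof (induction xs)
  case Nil
  show ?case by (rule extpol_eqI) (simp add: component_one component_monomial)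
next
  case (Cons x xs)
  show ?case
  proof (rule extpol_eqI)
    fix S :: "nat set" assume S: "finite S"
    \<comment> \<open>The head is smaller than all later indices, so there are no inversions and no
      sign.\<close>
    have sh: "shuffle_sign {x} (set xs) = (1 :: 'p pol)"
    proof -
      have "{(a, b). a \<in> {x} \<and> b \<in> set xs \<and> b < a} = {}" using Cons.prems by auto
      then show ?thesis unfolding shuffle_sign_def by (simp only: card.empty power_0)
    qed
    have "component (gen_x x * monomial (set xs) 0) S
        = (\<Sum>U\<in>Pow S. if U = {x} then (if S - {x} = set xs then 1 else 0) else (0 :: 'p pol))"
      unfolding component_times[OF S] gen_x_def
      by (intro sum.cong refl) (auto simp: component_monomial sh)
    also have "\<dots> = (if x \<in> S \<and> S - {x} = set xs then 1 else 0)"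
      using S by (simp add: sum.delta)
    also have "x \<in> S \<and> S - {x} = set xs \<longleftrightarrow> S = set (x # xs)"
      using Cons.prems by auto
    finally show "component (prod_list (map gen_x (x # xs))) S
        = (component (monomial (set (x # xs)) 0) S :: 'p pol)"
      using Cons by (simp add: component_monomial)
  qed
qed

section \<open>Components of tensor products at 1 and at \<xi>_i\<close>

lemma lookup_Delta: "Poly_Mapping.lookup (Delta i) k = (if k = i \<and> 1 \<le> i then 1 else 0)"
  by (auto simp: Delta_def lookup_single when_def)

lemma Delta_eq_iff: "Delta i = Delta j \<longleftrightarrow> i = j"
proof
  assume "Delta i = Delta j"
  then have "Poly_Mapping.lookup (Delta i) k = Poly_Mapping.lookup (Delta j) k" for k
    by (rule arg_cong)
  from this[of i] this[of j] show "i = j"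
    by (auto simp: lookup_Delta split: if_splits)
qed simp

lemma tensor_mult_zero:
  "tensor_mult f g ({}, 0) = f ({}, 0) * g ({}, 0)"
proof -
  have "Q + Q' = 0 \<longleftrightarrow> Q = 0 \<and> Q' = 0" for Q Q' :: "nat \<Rightarrow>\<^sub>0 nat"
  proof
    assume "Q + Q' = 0"
    then show "Q = 0 \<and> Q' = 0"
      by (intro conjI poly_mapping_eqI) (metis add_is_0 lookup_add lookup_zero)+
  qed simp
  then have "{(Q, Q'). Q + Q' = (0 :: nat \<Rightarrow>\<^sub>0 nat)} = {(0, 0)}"
    by simp
  then show ?thesis by (simp add: tensor_mult_def scalar_one)
qed

text \<open>\<Delta>_i splits only as 0 + \<Delta>_i or \<Delta>_i + 0. With no exterior factor, the
  shuffle sign and the involution are trivial, so the Leibniz rule is ungraded.\<close>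

lemma tensor_mult_Delta:
  assumes "1 \<le> i"
  shows "tensor_mult f g ({}, Delta i) = f ({}, 0) * g ({}, Delta i) + f ({}, Delta i) * g ({}, 0)"
proof -
  have *: "Q = 0 \<and> Q' = Delta i \<or> Q = Delta i \<and> Q' = 0" if "Q + Q' = Delta i" for Q Q'
  proof -
    have eq: "Poly_Mapping.lookup Q k + Poly_Mapping.lookup Q' k = (if k = i then 1 else 0)" for k
      unfolding lookup_add[symmetric] that using assms by (simp add: lookup_Delta)
    show ?thesis
    proof (cases "Poly_Mapping.lookup Q i = 0")
      case True
      then have "Q = 0" using eq by (intro poly_mapping_eqI) (metis add_is_0 lookup_zero)
      then show ?thesis using that by simp
    next
      case False
      then have "Poly_Mapping.lookup Q' i = 0" using eq[of i] by simp
      then have "Q' = 0" using eq by (intro poly_mapping_eqI) (metis add_is_0 lookup_zero)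
      then show ?thesis using that by simp
    qed
  qed
  have "{(Q, Q'). Q + Q' = Delta i} = {(0, Delta i), (Delta i, 0)}"
    using * by auto
  moreover have "Delta i \<noteq> 0"
    using lookup_Delta[of i i] assms by auto
  ultimately show ?thesis by (simp add: tensor_mult_def scalar_one)
qed

lemma Delta_zero: "Delta 0 = 0"
  by (simp add: Delta_def)

lemma coaction_y_Delta: "coaction_y m ({}, Delta j) = (of_pol (gen_y m ^ (CARD('p) ^ j)) :: 'p::prime_card extpol)"
  by (simp add: coaction_y_def Delta_eq_iff)

lemma coaction_x_empty: "coaction_x m ({}, R) = (if R = 0 then gen_x m else 0)"
  by (simp add: coaction_x_def)

text \<open>The counit property: at \<open>({}, 0)\<close> the coactions of the generators return
  the generators, and this component is multiplicative.\<close>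

lemma tensor_prod_zero:
  "tensor_prod (map coaction_x xs @ map coaction_y ws) ({}, 0)
   = prod_list (map gen_x xs) * (of_pol (prod_list (map gen_y ws)) :: 'p::prime_card extpol)"
proof -
  have "tensor_prod (map coaction_y ws) ({}, 0) = (of_pol (prod_list (map gen_y ws)) :: 'p extpol)"
  proof (induction ws)
    case (Cons w ws)
    have "coaction_y w ({}, 0) = (of_pol (gen_y w) :: 'p extpol)"
      using coaction_y_Delta[of w 0] by (simp add: Delta_zero)
    with Cons show ?case
      by (simp add: tensor_prod_def tensor_mult_zero of_pol_mult)
  qed (simp add: tensor_prod_def tensor_one_def)
  then show ?thesis
    by (induction xs) (simp_all add: tensor_prod_def tensor_mult_zero coaction_x_empty mult.assoc)
qed

text \<open>As i \<ge> 1, \<open>coaction_x\<close> vanishes at \<open>({}, Delta i)\<close>, so the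
  x's are only carried along while the y's reproduce the recursion of
  \<open>word_deriv\<close>.\<close>

lemma tensor_prod_Delta:
  assumes "1 \<le> i"
  shows "tensor_prod (map coaction_x xs @ map coaction_y ws) ({}, Delta i)
   = prod_list (map gen_x xs) * (of_pol (word_deriv i ws) :: 'p::prime_card extpol)"
proof -
  have nz: "Delta i \<noteq> 0" using Delta_eq_iff[of i 0] assms by (simp add: Delta_zero)
  have "tensor_prod (map coaction_y ws) ({}, Delta i) = (of_pol (word_deriv i ws) :: 'p extpol)"
  proof (induction ws)
    case (Cons w ws)
    have "tensor_prod (map coaction_y ws) ({}, 0) = (of_pol (prod_list (map gen_y ws)) :: 'p extpol)"
      using tensor_prod_zero[of "[]" ws] by simp
    moreover have "coaction_y w ({}, 0) = (of_pol (gen_y w) :: 'p extpol)"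
      using coaction_y_Delta[of w 0] by (simp add: Delta_zero)
    ultimately show ?case
      using Cons
      by (simp add: tensor_prod_def tensor_mult_Delta[OF assms] of_pol_add of_pol_mult
          coaction_y_Delta)
  qed (simp add: tensor_prod_def tensor_one_def nz)
  then show ?thesis
    by (induction xs)
      (simp_all add: tensor_prod_def tensor_mult_Delta[OF assms] coaction_x_empty nz mult.assoc)
qed

lemma coaction_monomial_alt:
  "coaction_monomial I e
   = tensor_prod (map coaction_x (sorted_list_of_set I) @ map coaction_y (monomial_word e))"
  by (simp add: coaction_monomial_def monomial_word_def map_concat comp_def)

text \<open>If the coaction at \<open>SR\<close> keeps the exterior part of each monomial, then only
  the summand \<open>I = S\<close> reaches the component at \<open>S\<close>. It is used for the
  identity and for the derivation.\<close>

lemma component_coaction: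
  fixes z :: "'p::prime_card extpol"
  assumes "\<And>I e. finite I \<Longrightarrow> coaction_monomial I e SR = monomial I 0 * (of_pol (f e) :: 'p extpol)"
  shows "component (coaction z SR) S = (\<Sum>e\<in>Poly_Mapping.keys (component z S).
     Poly_Mapping.single 0 (Poly_Mapping.lookup (component z S) e) * f e)"
proof -
  let ?F = "\<lambda>I. \<Sum>e\<in>Poly_Mapping.keys (component z I).
     Poly_Mapping.single 0 (Poly_Mapping.lookup (component z I) e) * f e"
  have "component (coaction z SR) S = (\<Sum>I | component z I \<noteq> 0. if I = S then ?F S else 0)"
    unfolding coaction_def component_sum
  proof (intro sum.cong refl)
    fix I assume "I \<in> {I. component z I \<noteq> 0}"
    then have I: "finite I" using component_infinite by blast
    show "(\<Sum>e\<in>Poly_Mapping.keys (component z I).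
        component (scalar (coefficient z I e) * coaction_monomial I e SR) S) = (if I = S then ?F S else 0)"
      by (auto simp: assms[OF I] scalar_def coefficient_def component_of_pol_times
          component_times_of_pol component_monomial[OF I])
  qed
  also have "\<dots> = ?F S"
    using component_finite[of z] by (simp add: sum.delta)
  finally show ?thesis .
qed

lemma prod_list_gen_x_set:
  "finite I \<Longrightarrow> prod_list (map gen_x (sorted_list_of_set I)) = monomial I 0"
  by (simp add: prod_list_gen_x)

lemma Delta_milnor_index: "({}, Delta i) \<in> milnor_indices"
  by (auto simp: milnor_indices_def Delta_def split: if_splits)

lemma act_St_Delta_zero: "act (St {} (Delta 0)) z = z"
proof (rule extpol_eqI)
  fix S
  have single: "Poly_Mapping.single 0 c * Poly_Mapping.single e 1 = Poly_Mapping.single e (c :: 'a mod_ring)"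
    for e :: "nat \<Rightarrow>\<^sub>0 nat" and c
    by (simp add: mult_single)
  show "component (act (St {} (Delta 0)) z) S = component z S"
    unfolding act_St[OF Delta_milnor_index] unfolding Delta_zero
    by (subst component_coaction[where f = "\<lambda>e. Poly_Mapping.single e 1"])
      (simp_all only: coaction_monomial_alt tensor_prod_zero prod_list_gen_x_set
        prod_monomial_word single flip: poly_mapping_sum_single)
qed

lemma component_act_St_Delta:
  assumes "1 \<le> i"
  shows "component (act (St {} (Delta i)) z) S = milnor_deriv i (component z S)"
  unfolding act_St[OF Delta_milnor_index] milnor_deriv_def
  by (rule component_coaction)
    (simp only: coaction_monomial_alt tensor_prod_Delta[OF assms] prod_list_gen_x_set)

section \<open>Brackets\<close>

lemma arrangement_nth:
  assumes "I \<subseteq> {1..n}" "j < n"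
  shows "arrangement n I ! j \<in> {1..n}"
proof -
  have "finite I" using assms finite_subset by blast
  then have "set (arrangement n I) = {1..n}"
    using assms(1) by (auto simp: arrangement_def)
  moreover have "length (arrangement n I) = n"
    using card_mono[OF _ assms(1)] \<open>finite I\<close> assms(1)
    by (simp add: arrangement_def card_Diff_subset)
  ultimately show ?thesis using assms(2) nth_mem by metis
qed

text \<open>The summand of \<open>I\<close> lives in the component at \<open>I\<close> alone, so
  identities between brackets reduce to identities between Moore determinants.\<close>

lemma component_bracket:
  assumes "length as = n - k"
  shows "component (bracket n k as) S = (if S \<subseteq> {1..n} \<and> card S = k
     then of_int (sign (sigma n S)) * moore (\<lambda>u. gen_y (arrangement n S ! (k + u))) as else 0)"
    (is "_ = (if ?P S then ?c S else 0)")
proof -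
  have fin: "finite {I. ?P I}"
    by (rule finite_subset[of _ "Pow {1..n}"]) auto
  have "component (bracket n k as) S = (\<Sum>I | ?P I. if I = S then ?c S else 0)"
    unfolding bracket_def component_sum
  proof (intro sum.cong refl)
    fix I assume "I \<in> {I. ?P I}"
    then have I: "finite I" using finite_subset by auto
    show "component (of_int (sign (sigma n I)) * prod_list (map gen_x (sorted_list_of_set I))
        * of_pol (det (mat (n - k) (n - k)
         (\<lambda>(u, v). gen_y (arrangement n I ! (k + u)) ^ (CARD('a) ^ (as ! v)))))) S
      = (if I = S then ?c S else 0)"
      by (simp add: component_times_of_pol component_sign_times prod_list_gen_x_set[OF I]
          component_monomial[OF I] moore_def assms)
  qed
  also have "\<dots> = (if ?P S then ?c S else 0)"
    using fin by (simp add: sum.delta)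
  finally show ?thesis .
qed

lemma bracket_not_distinct:
  assumes "length as = n - k" "\<not> distinct as"
  shows "bracket n k as = 0"
  by (rule extpol_eqI) (simp add: component_bracket assms moore_not_distinct)

lemma bracket_move_first:
  assumes "length (a # cs @ ds) = n - k"
  shows "bracket n k (a # cs @ ds) = ((-1) ^ length cs * bracket n k (cs @ a # ds) :: 'p::prime_card extpol)"
proof (rule extpol_eqI)
  fix S
  have "moore g (a # cs @ ds) = (-1) ^ length cs * moore g (cs @ a # ds)" for g :: "nat \<Rightarrow> 'p pol"
    using moore_move[of g "[]" a cs ds] by simp
  moreover have "length (cs @ a # ds) = n - k" using assms by simp
  ultimately show "component (bracket n k (a # cs @ ds)) S
      = component ((-1) ^ length cs * bracket n k (cs @ a # ds) :: 'p extpol) S"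
    by (simp add: component_minus_one_power_times component_bracket[OF assms] component_bracket mult_ac)
qed

text \<open>All rows, in every component, are among y_1, ..., y_n, so a single relation expands all
  the determinants at once.\<close>

lemma bracket_expand_first:
  fixes d :: "nat \<Rightarrow> 'p::prime_card pol"
  assumes "Suc (length bs) = n - k"
    and d: "\<And>i. 1 \<le> i \<Longrightarrow> i \<le> n \<Longrightarrow> gen_y i ^ (CARD('p) ^ n) = (\<Sum>s<n. d s * gen_y i ^ (CARD('p) ^ s))"
  shows "bracket n k (n # bs) = (\<Sum>s<n. bracket n k (s # bs) * of_pol (d s))"
proof (rule extpol_eqI)
  fix S
  have len: "length (a # bs) = n - k" for a using assms by simp
  have moore: "moore (\<lambda>u. gen_y (arrangement n S ! (k + u))) (n # bs)
      = (\<Sum>s<n. d s * moore (\<lambda>u. gen_y (arrangement n S ! (k + u))) (s # bs))"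
    if "S \<subseteq> {1..n}"
  proof (rule moore_expand_first)
    fix u assume "u \<le> length bs"
    then have "k + u < n" using assms(1) by simp
    then show "gen_y (arrangement n S ! (k + u)) ^ (CARD('p) ^ n)
        = (\<Sum>s<n. d s * gen_y (arrangement n S ! (k + u)) ^ (CARD('p) ^ s))"
      using arrangement_nth[OF that] by (intro d) auto
  qed
  show "component (bracket n k (n # bs)) S
      = component (\<Sum>s<n. bracket n k (s # bs) * of_pol (d s)) S"
  proof (cases "S \<subseteq> {1..n} \<and> card S = k")
    case True
    then show ?thesis
      using moore
      by (simp add: component_sum component_times_of_pol component_bracket[OF len]
        sum_distrib_left mult_ac)
  next
    case False
    then show ?thesis
      by (simp only: component_sum component_times_of_pol component_bracket[OF len] if_False
        mult_zero_left sum.neutral_const)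
  qed
qed

lemma milnor_deriv_sign_times: "milnor_deriv i (of_int (sign \<pi>) * q) = of_int (sign \<pi>) * milnor_deriv i q"
  using milnor_deriv_mult[of i "- 1" q] by (simp add: sign_def milnor_deriv_minus_one)

lemma act_St_Delta_bracket_zero:
  assumes "Suc (length bs) = n - k" and "\<And>b. b \<in> set bs \<Longrightarrow> 0 < b"
  shows "act (St {} (Delta i)) (bracket n k (0 # bs)) = bracket n k (i # bs)"
\<comment> \<open>For i = 0 the operation is the identity and not the derivation y_m \<mapsto> y_m,
  so this case is separate.\<close>
proof (cases "i = 0")
  case True
  then show ?thesis by (simp add: act_St_Delta_zero del: One_nat_def)
next
  case False
  then have i: "1 \<le> i" by simp
  have len: "length (a # bs) = n - k" for a using assms by simp
  show ?thesis
    by (rule extpol_eqI)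
      (simp add: component_act_St_Delta[OF i] component_bracket[OF len] milnor_deriv_sign_times
        milnor_deriv_moore_zero[OF assms(2)])
qed

lemma act_St_Delta_bracket_positive:
  assumes "length as = n - k" and "\<And>b. b \<in> set as \<Longrightarrow> 0 < b" and i: "1 \<le> i"
  shows "act (St {} (Delta i)) (bracket n k as) = 0"
  by (rule extpol_eqI)
    (simp add: component_act_St_Delta[OF i] component_bracket[OF assms(1)] milnor_deriv_sign_times
      milnor_deriv_moore_positive[OF assms(2)])

text \<open>The case s_1 = 0, i = 0 stands apart because \<Delta>_0 = 0 gives the identity
  operation, whose value is M and not 0: for n = k = 1 it is x_1. For s_1 > 0, i = 0 is the first
  case with t = 0.\<close>

theorem proposition4p4:
  fixes n k i :: nat and s :: "nat \<Rightarrow> nat"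
  assumes "odd CARD('p::prime_card)" and "1 \<le> n" and "1 \<le> k" and "k \<le> n"
    and "strict_mono_on {1..k} s" and "s k \<le> n - 1" and "s 0 = 0" and "i \<le> n"
  shows "let StM = act (St {} (Delta i)) (mui_M n (map s [1..<k + 1])) :: 'p extpol;
             M_omit = (\<lambda>t. mui_M n (map s (filter (\<lambda>j. j \<noteq> t) [0..<k + 1])))
         in (\<forall>t\<le>k. s 1 > 0 \<and> i = s t \<longrightarrow> StM = (-1) ^ (s t - t) * M_omit t)
          \<and> (s 1 > 0 \<and> i = n \<longrightarrow>
               StM = (\<Sum>t=0..k. (-1) ^ (n - t - 1) * M_omit t * of_pol (dickson_Q n (s t))))
          \<and> (s 1 = 0 \<and> i = 0 \<longrightarrow> StM = mui_M n (map s [1..<k + 1]))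
          \<and> (\<not> (s 1 > 0 \<and> (\<exists>t\<le>k. i = s t)) \<and> \<not> (s 1 > 0 \<and> i = n) \<and> \<not> (s 1 = 0 \<and> i = 0) \<longrightarrow>
               StM = 0)"
proof -
  define M where "M = (mui_M n (map s [1..<k + 1]) :: 'p extpol)"
  define StM where "StM = act (St {} (Delta i)) M"
  define M_omit where "M_omit = (\<lambda>t. mui_M n (map s (filter (\<lambda>j. j \<noteq> t) [0..<k + 1])) :: 'p extpol)"
  have s_less: "s a < s b" if "1 \<le> a" "a < b" "b \<le> k" for a b
    using assms(5) that by (auto simp: strict_mono_on_def)
  show ?thesis
  proof (cases "s 1 = 0")
    case True
    define as where "as = filter (\<lambda>a. a \<notin> s ` {1..k}) [0..<n]"
    have sub: "s ` {1..k} \<subseteq> {0..<n}"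
    proof
      fix x assume "x \<in> s ` {1..k}"
      then obtain j where "x = s j" "1 \<le> j" "j \<le> k" by auto
      then have "x \<le> s k" using s_less[of j k] by (cases "j = k") auto
      then show "x \<in> {0..<n}" using assms by auto
    qed
    have "card (s ` {1..k}) = k"
      using assms(5) by (simp add: card_image strict_mono_on_imp_inj_on)
    then have len: "length as = n - k"
      using length_filter_notin_upt[OF sub] by (simp add: as_def)
    have set_s: "set (map s [1..<k + 1]) = s ` {1..k}" by auto
    have M: "M = bracket n k as"
      unfolding M_def mui_M_def set_s as_def by (simp del: upt_Suc)
    \<comment> \<open>The exponent 0 = s_1 is among the omitted ones.\<close>
    have "0 < b" if "b \<in> set as" for b
    proof (rule ccontr)
      assume "\<not> 0 < b"
      moreover have "0 \<in> s ` {1..k}" by (metis True assms(3) atLeastAtMost_iff imageI order_refl)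
      ultimately show False using that by (simp add: as_def)
    qed
    then have "StM = 0" if "1 \<le> i"
      unfolding StM_def M by (rule act_St_Delta_bracket_positive[OF len _ that])
    moreover have "StM = M" if "i = 0"
      unfolding StM_def that by (rule act_St_Delta_zero)
    ultimately show ?thesis
      unfolding Let_def M_def[symmetric] StM_def[symmetric] using True by auto
  next
    case False
    define V where "V = s ` {0..k}"
    \<comment> \<open>These exponents are common to all \<open>M_omit t\<close>, each of which has
      s_t as its one additional exponent. They are positive since s_0 = 0 lies in
      \<open>V\<close>.\<close>
    define bs where "bs = filter (\<lambda>a. a \<notin> V) [0..<n]"
    define omit where "omit = (\<lambda>t. filter (\<lambda>a. a \<notin> V - {s t}) [0..<n])"
    have s_mono: "s a < s b" if "a < b" "b \<le> k" for a b
    proof (cases "a = 0")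
      case True
      have "0 < s b"
      proof (cases "b = 1")
        case False
        then show ?thesis using s_less[of 1 b] that True by simp
      qed (use \<open>s 1 \<noteq> 0\<close> in simp)
      then show ?thesis using True assms by simp
    qed (use s_less[of a b] that in simp)
    have s_inj: "s a = s b \<longleftrightarrow> a = b" if "a \<le> k" "b \<le> k" for a b
      using s_mono[of a b] s_mono[of b a] that by (cases a b rule: linorder_cases) auto
    have s_bound: "s t < n" if "t \<le> k" for t
      using s_mono[of t k] that assms by (cases "t = k") auto
    have s_ge: "t \<le> s t" if "t \<le> k" for t
      using that
    proof (induction t)
      case (Suc t)
      then show ?case using s_mono[of t "Suc t"] by simp
    qed simp
    have V_sub: "V \<subseteq> {0..<n}" using s_bound by (auto simp: V_def)
    have inj: "inj_on s {0..k}" using s_inj by (auto simp: inj_on_def)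
    have card_V: "card V = Suc k" using inj by (simp add: V_def card_image)
    \<comment> \<open>The k + 1 distinct values s_0, ..., s_k lie below n, so k < n and there is a
      column for the additional exponent.\<close>
    have "Suc k \<le> n" using card_mono[OF _ V_sub] card_V by simp
    have len: "Suc (length bs) = n - k"
      using length_filter_notin_upt[OF V_sub] \<open>Suc k \<le> n\<close> by (simp add: bs_def card_V)
    have pos: "0 < b" if "b \<in> set bs" for b
    proof (rule ccontr)
      assume "\<not> 0 < b"
      moreover have "0 \<in> V" unfolding V_def by (metis assms(7) atLeastAtMost_iff imageI le0 order_refl)
      ultimately show False using that by (simp add: bs_def)
    qed
    have omit: "M_omit t = bracket n k (omit t)" if "t \<le> k" for t
    proof -
      have "set (map s (filter (\<lambda>j. j \<noteq> t) [0..<k + 1])) = V - {s t}"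
        using that by (auto simp: V_def s_inj)
      moreover have "length (filter (\<lambda>j. j \<noteq> t) [0..<k + 1]) = k"
        using that by (simp add: filter_neq_upt del: upt_Suc)
      ultimately show ?thesis unfolding M_omit_def mui_M_def omit_def by simp
    qed
    \<comment> \<open>Bringing s_t from the front to its sorted place passes the s_t - t entries of
      \<open>bs\<close> below s_t.\<close>
    have move: "bracket n k (s t # bs) = (-1) ^ (s t - t) * M_omit t" if t: "t \<le> k" for t
    proof -
      define cs where "cs = filter (\<lambda>a. a \<notin> V) [0..<s t]"
      define ds where "ds = filter (\<lambda>a. a \<notin> V) [Suc (s t)..<n]"
      have split: "[0..<n] = [0..<s t] @ s t # [Suc (s t)..<n]"
        by (rule upt_split_at[OF s_bound[OF t], symmetric])
      have st: "s t \<in> V" using t by (simp add: V_def)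
      have "bs = cs @ ds"
        unfolding bs_def split cs_def ds_def using st by simp
      moreover have "omit t = cs @ s t # ds"
      proof -
        have "filter (\<lambda>a. a \<notin> V - {s t}) xs = filter (\<lambda>a. a \<notin> V) xs" if "s t \<notin> set xs" for xs
          using that by (intro filter_cong) auto
        then show ?thesis unfolding omit_def split cs_def ds_def by simp
      qed
      \<comment> \<open>The elements of \<open>V\<close> below s_t are exactly s_0, ...,
        s_{t-1}.\<close>
      moreover have "length cs = s t - t"
      proof -
        have "cs = filter (\<lambda>a. a \<notin> s ` {0..<t}) [0..<s t]"
          unfolding cs_def
        proof (rule filter_cong[OF refl])
          fix a assume "a \<in> set [0..<s t]"
          then have "a < s t" by simp
          have "j < t" if "a = s j" "j \<le> k" for j
            using s_mono[of t j] s_inj[of t j] that \<open>a < s t\<close> t by (cases t j rule: linorder_cases) auto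
          then show "a \<notin> V \<longleftrightarrow> a \<notin> s ` {0..<t}" using t by (auto simp: V_def)
        qed
        moreover have "s ` {0..<t} \<subseteq> {0..<s t}" using s_mono t by auto
        moreover have "card (s ` {0..<t}) = t"
          using t by (subst card_image) (auto intro: inj_on_subset[OF inj])
        ultimately show ?thesis using length_filter_notin_upt by metis
      qed
      ultimately show ?thesis
        using bracket_move_first[of "s t" cs ds n k] len omit[OF t] by simp
    qed
    \<comment> \<open>M omits s_1, ..., s_k, so it is \<open>M_omit 0\<close>, and its first
      exponent is s_0 = 0.\<close>
    have "filter (\<lambda>j. j \<noteq> 0) [0..<k + 1] = [1..<k + 1]"
      by (subst filter_neq_upt) simp_all
    then have "M = M_omit 0"
      unfolding M_def M_omit_def by (simp only:)
    then have "M = bracket n k (0 # bs)"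
      using move[of 0] assms(7) by simp
    then have StM: "StM = bracket n k (i # bs)"
      unfolding StM_def using act_St_Delta_bracket_zero[OF len pos] by simp
    have "StM = (\<Sum>t=0..k. (-1) ^ (n - t - 1) * M_omit t * of_pol (dickson_Q n (s t)))" if "i = n"
    proof -
      obtain d :: "nat \<Rightarrow> 'p pol"
        where d: "\<And>i. 1 \<le> i \<Longrightarrow> i \<le> n \<Longrightarrow>
            gen_y i ^ (CARD('p) ^ n) = (\<Sum>s<n. d s * gen_y i ^ (CARD('p) ^ s))"
          and Q: "\<And>s. s < n \<Longrightarrow> d s = (-1) ^ (n - 1 - s) * dickson_Q n s"
        using dickson_power_relation by blast
      have "StM = (\<Sum>r<n. bracket n k (r # bs) * of_pol (d r))"
        unfolding StM that by (rule bracket_expand_first[OF len d])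
      also have "\<dots> = (\<Sum>r\<in>V. bracket n k (r # bs) * of_pol (d r))"
      proof (rule sum.mono_neutral_right)
        show "\<forall>r\<in>{..<n} - V. bracket n k (r # bs) * of_pol (d r) = 0"
        proof
          \<comment> \<open>An exponent below n outside \<open>V\<close> occurs in \<open>bs\<close>
            and gives a repeated column.\<close>
          fix r assume "r \<in> {..<n} - V"
          then have "\<not> distinct (r # bs)" by (simp add: bs_def)
          then have "bracket n k (r # bs) = (0 :: 'p extpol)"
            using len by (intro bracket_not_distinct) auto
          then show "bracket n k (r # bs) * of_pol (d r) = 0" by simp
        qed
      qed (use V_sub in auto)
      also have "\<dots> = (\<Sum>t=0..k. bracket n k (s t # bs) * of_pol (d (s t)))"
        unfolding V_def by (simp add: sum.reindex[OF inj])
      also have "\<dots> = (\<Sum>t=0..k. (-1) ^ (n - t - 1) * M_omit t * of_pol (dickson_Q n (s t)))"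
      proof (intro sum.cong refl)
        fix t assume "t \<in> {0..k}"
        then have t: "t \<le> k" by simp
        \<comment> \<open>The signs from \<open>move\<close> and from the Dickson relation combine;
          t \<le> s_t < n keeps the natural subtractions from truncating.\<close>
        have "n - t - 1 = (s t - t) + (n - 1 - s t)"
          using s_ge[OF t] s_bound[OF t] by simp
        then show "bracket n k (s t # bs) * of_pol (d (s t))
            = (-1) ^ (n - t - 1) * M_omit t * of_pol (dickson_Q n (s t))"
          unfolding move[OF t] Q[OF s_bound[OF t]]
          by (intro extpol_eqI)
            (simp only: component_times_of_pol component_minus_one_power_times power_add mult_ac)
      qed
      finally show ?thesis .
    qed
    moreover have "StM = 0" if "\<not> (\<exists>t\<le>k. i = s t)" "i \<noteq> n"
    proof -
      \<comment> \<open>Here i < n lies outside \<open>V\<close>, hence in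
        \<open>bs\<close>.\<close>
      have "\<not> distinct (i # bs)"
        using that assms(8) by (auto simp: bs_def V_def)
      then show ?thesis unfolding StM using len by (intro bracket_not_distinct) auto
    qed
    moreover have "StM = (-1) ^ (s t - t) * M_omit t" if "t \<le> k" "i = s t" for t
      using move[OF that(1)] StM that(2) by simp
    ultimately show ?thesis
      unfolding Let_def M_def[symmetric] StM_def[symmetric] M_omit_def using False by auto
  qed
qed

end
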